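(* Let $T\subset\mathbb{R}^2$ be a (non-degenerate) triangle with vertices $p_0,p_1,p_2$, and for each $n$ let $L_n$ be the length of a longest convex chain (from $p_0$ to $p_2$) in a sample of $n$ independent uniform random points of $T$. Then there exists a positive constant $\alpha$ for which $$\lim_{n\to\infty}\frac{\mathbb{E}L_n}{\sqrt[3]{n}}=\alpha .$$
   Context: Let $T$ be a triangle with vertices $p_0,p_1,p_2$ and let $X\subset T$ be finite. A subset $Y\subset X$ is a convex chain in $T$ (from $p_0$ to $p_2$) if the convex hull of $Y\cup\{p_0,p_2\}$ is a convex polygon with exactly $|Y|+2$ vertices. The length of the convex chain $Y$ is $|Y|$. $X_n$ denotes a random sample of $n$ independent points, each uniformly distributed in $T$ (normalized Lebesgue measure), and $L_n$ is the maximum of $|Y|$ over all convex chains $Y\subset X_n$ from $p_0$ to $p_2$. *)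

theory Defs
  imports "HOL-Probability.Probability"
begin

definition triangle :: "real^2 \<Rightarrow> real^2 \<Rightarrow> real^2 \<Rightarrow> (real^2) set" where
  "triangle p0 p1 p2 = convex hull {p0, p1, p2}"

text \<open>
  The vertices of a convex polygon are its extreme points. The empty set counts as a chain of
  length 0: its hull is the segment from \<open>p0\<close> to \<open>p2\<close>, a degenerate polygon with 2 vertices.
  For nonempty \<open>Y\<close> the hull has at least 3 extreme points, so it is a genuine polygon.
\<close>

definition convex_chain :: "real^2 \<Rightarrow> real^2 \<Rightarrow> real^2 \<Rightarrow> (real^2) set \<Rightarrow> bool" where
  "convex_chain p0 p1 p2 Y \<longleftrightarrow>
     finite Y \<and> Y \<subseteq> triangle p0 p1 p2 \<and>
     card {v. v extreme_point_of (convex hull (Y \<union> {p0, p2}))} = card Y + 2"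

definition longest_chain_length :: "real^2 \<Rightarrow> real^2 \<Rightarrow> real^2 \<Rightarrow> (real^2) set \<Rightarrow> nat" where
  "longest_chain_length p0 p1 p2 X = Max {card Y | Y. Y \<subseteq> X \<and> convex_chain p0 p1 p2 Y}"

text \<open>
  The joint law of \<open>n\<close> independent uniform points. An outcome is a function \<open>x\<close> on
  \<open>{..<n}\<close>, and the sample is the set of its values; almost surely it consists of
  \<open>n\<close> distinct points of the triangle.
\<close>

definition sample_measure :: "real^2 \<Rightarrow> real^2 \<Rightarrow> real^2 \<Rightarrow> nat \<Rightarrow> (nat \<Rightarrow> real^2) measure" where
  "sample_measure p0 p1 p2 n = (\<Pi>\<^sub>M i\<in>{..<n}. uniform_measure lborel (triangle p0 p1 p2))"

definition expected_longest_chain :: "real^2 \<Rightarrow> real^2 \<Rightarrow> real^2 \<Rightarrow> nat \<Rightarrow> real" where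
  "expected_longest_chain p0 p1 p2 n =
     prob_space.expectation (sample_measure p0 p1 p2 n)
       (\<lambda>x. real (longest_chain_length p0 p1 p2 (x ` {..<n})))"

end

theory Submission
  imports Defs "HOL-Real_Asymp.Real_Asymp"
begin

text \<open>
  The expected length \<open>f n\<close> is the same for all triangles, since affine maps preserve both chains and
  uniform distributions. Inscribe in the triangle the parabola tangent to its sides at \<open>p0\<close> and \<open>p2\<close>:
  tangents at \<open>k + 1\<close> suitable points of the parabola cut off \<open>k\<close> triangles of relative area \<open>1 / k\<^sup>3\<close>,
  and chains in these triangles combine to one chain of the big triangle. Each small triangle contains
  a binomially distributed number of sample points, so Chebyshev's inequality gives
  \<open>f n \<ge> (1 - o(1)) k f m\<close> for \<open>n\<close> slightly larger than \<open>m k\<^sup>3\<close>. This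
  superadditivity yields convergence of \<open>f n / n\<^bsup>1/3\<^esup>\<close> to a positive
  limit, once \<open>f n = O(n\<^bsup>1/3\<^esup>)\<close> is known. For this bound, peeling
  off the first point of a chain shows that \<open>k\<close> given sample points form a chain in the given
  order with probability at most \<open>4\<^sup>k / (k!)\<^sup>3\<close>. All subsets of a chain are chains, so the
  expectation of \<open>2\<close> to the length of a longest chain is at most
  \<open>\<Sum>k. (4 n)\<^sup>k / (k!)\<^sup>3 \<le> exp (3 (4 n)\<^bsup>1/3\<^esup>)\<close>,
  and Jensen's inequality applies.
\<close>

section \<open>Convex position and longest chains\<close>

text \<open>Chains of the small triangles can be joined because the triangles are cut off by
  tangents: a line supporting a small chain has slope between those of the two tangents bounding its
  triangle, and every other small triangle lies above both tangents. The counts of sample points in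
  the small triangles are dependent, but by linearity of expectation only their marginal laws enter,
  and monotonicity of \<open>f\<close> turns binomial concentration into a comparison with
  \<open>f m\<close>. In the upper bound the cube of \<open>k!\<close> has three sources: with
  \<open>k\<close> points still to come, the position and the height of the peeled point each
  contribute an integral of a \<open>k\<close>-th power, and the shrinking width of the triangle
  contributes a further factor of order \<open>1 / k\<close>. The constant 4 bounds the density of
  the uniform law. The multiplicative loss in the superadditive inequality depends on
  \<open>m\<close> alone and vanishes as \<open>m\<close> grows. Hence the supremum of the
  discounted ratios is the limit over all \<open>n\<close>, without passing to subsequences.\<close>

definition in_convex_position :: "'a::euclidean_space set \<Rightarrow> bool" where
  "in_convex_position S \<longleftrightarrow> (\<forall>v\<in>S. v \<notin> convex hull (S - {v}))"

lemma extreme_point_of_convex_hull_finite_iff: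
  assumes "finite S" "v \<in> S"
  shows "v extreme_point_of (convex hull S) \<longleftrightarrow> v \<notin> convex hull (S - {v})"
proof
  assume ext: "v extreme_point_of (convex hull S)"
  have "convex (convex hull S - {v})"
    using ext extreme_point_of_stillconvex[of "convex hull S" v] by auto
  moreover have "S - {v} \<subseteq> convex hull S - {v}"
    using hull_subset[of S convex] by auto
  ultimately have "convex hull (S - {v}) \<subseteq> convex hull S - {v}"
    by (rule hull_minimal[rotated])
  then show "v \<notin> convex hull (S - {v})"
    by blast
next
  assume "v \<notin> convex hull (S - {v})"
  then have "v extreme_point_of (convex hull (insert v (S - {v})))"
    using assms by (intro extreme_point_of_convex_hull_insert) auto
  then show "v extreme_point_of (convex hull S)"
    using assms by (simp add: insert_absorb)
qed

text \<open>All extreme points of the hull lie in \<open>Y \<union> {p0, p2}\<close>, so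
  \<open>card Y + 2\<close> is the largest possible count. Attaining it forces \<open>p0\<close> and
  \<open>p2\<close> outside \<open>Y\<close> and makes every point extreme.\<close>

lemma convex_chain_iff:
  assumes "p0 \<noteq> p2"
  shows "convex_chain p0 p1 p2 Y \<longleftrightarrow>
    finite Y \<and> Y \<subseteq> triangle p0 p1 p2 \<and> p0 \<notin> Y \<and> p2 \<notin> Y \<and> in_convex_position (Y \<union> {p0, p2})"
    (is "?L \<longleftrightarrow> ?R")
proof
  let ?E = "{v. v extreme_point_of (convex hull (Y \<union> {p0, p2}))}"
  have sub: "?E \<subseteq> Y \<union> {p0, p2}"
    by (rule extreme_points_of_convex_hull)
  {
    assume ?L
    then have fin: "finite Y" and T: "Y \<subseteq> triangle p0 p1 p2" and c: "card ?E = card Y + 2"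
      by (auto simp: convex_chain_def)
    have "card Y + 2 \<le> card (Y \<union> {p0, p2})"
      using card_mono[OF _ sub] fin c by simp
    then have out: "p0 \<notin> Y" "p2 \<notin> Y"
      using fin assms by (auto simp: card_insert_if split: if_splits)
    then have "?E = Y \<union> {p0, p2}"
      using card_subset_eq[OF _ sub] fin c assms by simp
    then have "in_convex_position (Y \<union> {p0, p2})"
      using fin extreme_point_of_convex_hull_finite_iff[of "Y \<union> {p0, p2}"]
      unfolding in_convex_position_def by blast
    then show ?R
      using fin T out by blast
  }
  {
    assume ?R
    then have "?E = Y \<union> {p0, p2}"
      using extreme_point_of_convex_hull_finite_iff[of "Y \<union> {p0, p2}"] sub
      unfolding in_convex_position_def by auto
    then show ?L
      using \<open>?R\<close> assms by (auto simp: convex_chain_def card_insert_if)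
  }
qed

lemma in_convex_position_subset:
  "in_convex_position S \<Longrightarrow> R \<subseteq> S \<Longrightarrow> in_convex_position R"
  unfolding in_convex_position_def
  by (meson Diff_mono hull_mono order_refl subset_iff)

text \<open>Heredity serves twice: a longest chain can be cut down to any smaller size in the
  measurability proof, and its subsets are counted in the upper bound.\<close>

lemma convex_chain_subset:
  assumes "p0 \<noteq> p2" "convex_chain p0 p1 p2 Y" "Y' \<subseteq> Y"
  shows "convex_chain p0 p1 p2 Y'"
  using assms in_convex_position_subset[of "Y \<union> {p0, p2}" "Y' \<union> {p0, p2}"]
  by (auto simp: convex_chain_iff intro: finite_subset)

lemma convex_chain_empty: "p0 \<noteq> p2 \<Longrightarrow> convex_chain p0 p1 p2 {}"
  by (auto simp: convex_chain_iff in_convex_position_def insert_Diff_if)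

lemma not_in_convex_hull_finite_iff:
  fixes v :: "'a::euclidean_space"
  assumes "finite W"
  shows "v \<notin> convex hull W \<longleftrightarrow> (\<exists>d. \<forall>w\<in>W. d \<bullet> v < d \<bullet> w)"
proof
  assume "v \<notin> convex hull W"
  then obtain d b where "d \<bullet> v < b" "\<forall>w\<in>convex hull W. d \<bullet> w > b"
    using separating_hyperplane_closed_point[of "convex hull W" v] assms
    by (auto simp: finite_imp_compact compact_imp_closed compact_convex_hull)
  then show "\<exists>d. \<forall>w\<in>W. d \<bullet> v < d \<bullet> w"
    by (meson hull_inc order_less_trans)
next
  assume "\<exists>d. \<forall>w\<in>W. d \<bullet> v < d \<bullet> w"
  then obtain d where d: "\<And>w. w \<in> W \<Longrightarrow> d \<bullet> v < d \<bullet> w" by blast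
  have "convex hull W \<subseteq> {w. d \<bullet> w > d \<bullet> v}"
    using d by (intro hull_minimal convex_halfspace_gt) auto
  then show "v \<notin> convex hull W" by auto
qed

text \<open>The separating directions form a finite intersection of open half-spaces, so a dense set
  meets them if there are any. With \<open>D\<close> countable, the condition becomes a countable
  union of measurable ones.\<close>

lemma not_in_convex_hull_finite_iff_dense:
  fixes v :: "'a::euclidean_space"
  assumes "finite W" and D: "\<And>U::'a set. open U \<Longrightarrow> U \<noteq> {} \<Longrightarrow> \<exists>d\<in>D. d \<in> U"
  shows "v \<notin> convex hull W \<longleftrightarrow> (\<exists>d\<in>D. \<forall>w\<in>W. d \<bullet> v < d \<bullet> w)"
proof -
  let ?U = "\<Inter>w\<in>W. {d. d \<bullet> v < d \<bullet> w}"
  have "open ?U"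
    using assms(1) by (intro open_INT ballI open_Collect_less continuous_intros) auto
  then show ?thesis
    unfolding not_in_convex_hull_finite_iff[OF assms(1)] using D[of ?U] by blast
qed

section \<open>Longest chains in a finite set\<close>

lemma longest_chain_set_finite:
  "finite X \<Longrightarrow> finite {card Y | Y. Y \<subseteq> X \<and> convex_chain p0 p1 p2 Y}"
  by (rule finite_subset[of _ "card ` Pow X"]) auto

lemma card_le_longest_chain:
  "finite X \<Longrightarrow> Y \<subseteq> X \<Longrightarrow> convex_chain p0 p1 p2 Y \<Longrightarrow> card Y \<le> longest_chain_length p0 p1 p2 X"
  unfolding longest_chain_length_def by (rule Max_ge[OF longest_chain_set_finite]) auto

lemma longest_chain_attained:
  assumes "finite X" "p0 \<noteq> p2"
  obtains Y where "Y \<subseteq> X" "convex_chain p0 p1 p2 Y" "card Y = longest_chain_length p0 p1 p2 X"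
proof -
  have "longest_chain_length p0 p1 p2 X \<in> {card Y | Y. Y \<subseteq> X \<and> convex_chain p0 p1 p2 Y}"
    unfolding longest_chain_length_def
    using assms convex_chain_empty[of p0 p2 p1]
    by (intro Max_in longest_chain_set_finite) auto
  then show ?thesis using that by auto
qed

lemma longest_chain_le_card:
  "finite X \<Longrightarrow> p0 \<noteq> p2 \<Longrightarrow> longest_chain_length p0 p1 p2 X \<le> card X"
  by (metis card_mono longest_chain_attained)

lemma longest_chain_mono:
  "finite X' \<Longrightarrow> X \<subseteq> X' \<Longrightarrow> p0 \<noteq> p2 \<Longrightarrow>
    longest_chain_length p0 p1 p2 X \<le> longest_chain_length p0 p1 p2 X'"
  by (metis card_le_longest_chain finite_subset longest_chain_attained order_trans)

lemma longest_chain_insert_outside: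
  assumes "y \<notin> triangle p0 p1 p2"
  shows "longest_chain_length p0 p1 p2 (insert y Z) = longest_chain_length p0 p1 p2 Z"
proof -
  have "{card Y | Y. Y \<subseteq> insert y Z \<and> convex_chain p0 p1 p2 Y} =
        {card Y | Y. Y \<subseteq> Z \<and> convex_chain p0 p1 p2 Y}"
    using assms unfolding convex_chain_def by blast
  then show ?thesis by (simp add: longest_chain_length_def)
qed

section \<open>Measurability of the longest chain length\<close>

lemma measurable_in_convex_position [measurable]:
  fixes g :: "'i \<Rightarrow> 'b \<Rightarrow> 'a::euclidean_space"
  assumes fin: "finite I" and g [measurable]: "\<And>i. i \<in> I \<Longrightarrow> g i \<in> borel_measurable N"
  shows "Measurable.pred N (\<lambda>\<omega>. in_convex_position ((\<lambda>i. g i \<omega>) ` I))"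
proof -
  obtain D :: "'a set" where D: "countable D" "\<And>U. open U \<Longrightarrow> U \<noteq> {} \<Longrightarrow> \<exists>d\<in>D. d \<in> U"
    by (rule countable_dense_setE) blast
  \<comment> \<open>\<open>S - {v}\<close> removes a value, not an index, hence the guard
    \<open>g j \<omega> \<noteq> g i \<omega>\<close>: points may coincide.\<close>
  have "in_convex_position ((\<lambda>i. g i \<omega>) ` I) \<longleftrightarrow>
     (\<forall>i\<in>I. \<exists>d\<in>D. \<forall>j\<in>I. g j \<omega> \<noteq> g i \<omega> \<longrightarrow> d \<bullet> g i \<omega> < d \<bullet> g j \<omega>)" for \<omega>
    unfolding in_convex_position_def ball_simps
    by (subst not_in_convex_hull_finite_iff_dense[OF _ D(2)]) (use fin in \<open>auto 0 4\<close>)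
  moreover have "Measurable.pred N
     (\<lambda>\<omega>. \<forall>i\<in>I. \<exists>d\<in>D. \<forall>j\<in>I. g j \<omega> \<noteq> g i \<omega> \<longrightarrow> d \<bullet> g i \<omega> < d \<bullet> g j \<omega>)"
  proof (intro pred_intros_finite(3) fin)
    fix i assume [simp]: "i \<in> I"
    have "Measurable.pred N (\<lambda>\<omega>. \<forall>j\<in>I. g j \<omega> \<noteq> g i \<omega> \<longrightarrow> d \<bullet> g i \<omega> < d \<bullet> g j \<omega>)" for d
    proof (intro pred_intros_finite(3) fin)
      fix j assume [simp]: "j \<in> I"
      show "Measurable.pred N (\<lambda>\<omega>. g j \<omega> \<noteq> g i \<omega> \<longrightarrow> d \<bullet> g i \<omega> < d \<bullet> g j \<omega>)"
        by measurable
    qed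
    then show "Measurable.pred N (\<lambda>\<omega>. \<exists>d\<in>D. \<forall>j\<in>I. g j \<omega> \<noteq> g i \<omega> \<longrightarrow> d \<bullet> g i \<omega> < d \<bullet> g j \<omega>)"
      unfolding pred_def by (intro sets.sets_Collect_countable_Ex'[OF _ D(1)])
  qed
  ultimately show ?thesis by simp
qed

lemma closed_triangle: "closed (triangle p0 p1 p2)"
  by (simp add: triangle_def finite_imp_compact compact_imp_closed compact_convex_hull)

lemma bounded_triangle: "bounded (triangle p0 p1 p2)"
  by (simp add: triangle_def finite_imp_compact compact_imp_bounded compact_convex_hull)

lemma borel_triangle [measurable]: "triangle p0 p1 p2 \<in> sets borel"
  by (simp add: borel_closed closed_triangle)

lemma measurable_convex_chain:
  assumes "p0 \<noteq> p2" and fin: "finite I" and g [measurable]: "\<And>i. i \<in> I \<Longrightarrow> g i \<in> borel_measurable N"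
  shows "Measurable.pred N (\<lambda>\<omega>. convex_chain p0 p1 p2 ((\<lambda>i. g i \<omega>) ` I))"
proof -
  \<comment> \<open>Two option layers adjoin the constants \<open>p0\<close> and \<open>p2\<close>
    to the family, so that the whole point set is again an indexed image.\<close>
  define g' where "g' = (\<lambda>i \<omega>. case i of Some i \<Rightarrow> g i \<omega> | None \<Rightarrow> p0)"
  define h where "h = (\<lambda>i \<omega>. case i of Some i \<Rightarrow> g' i \<omega> | None \<Rightarrow> p2)"
  let ?J = "insert None (Some ` insert None (Some ` I))"
  have [measurable]: "h i \<in> borel_measurable N" if "i \<in> ?J" for i
    using that by (auto simp: h_def g'_def)
  have eq: "(\<lambda>i. h i \<omega>) ` ?J = (\<lambda>i. g i \<omega>) ` I \<union> {p0, p2}" for \<omega>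
    by (auto simp: h_def g'_def image_image)
  have "Measurable.pred N (\<lambda>\<omega>. in_convex_position ((\<lambda>i. g i \<omega>) ` I \<union> {p0, p2}))"
    unfolding eq[symmetric] using fin by (intro measurable_in_convex_position) auto
  moreover have "convex_chain p0 p1 p2 ((\<lambda>i. g i \<omega>) ` I) \<longleftrightarrow>
      (\<forall>i\<in>I. g i \<omega> \<in> triangle p0 p1 p2 \<and> g i \<omega> \<noteq> p0 \<and> g i \<omega> \<noteq> p2) \<and>
      in_convex_position ((\<lambda>i. g i \<omega>) ` I \<union> {p0, p2})" for \<omega>
    using fin by (auto simp: convex_chain_iff[OF assms(1)])
  moreover have "Measurable.pred N (\<lambda>\<omega>. \<forall>i\<in>I. g i \<omega> \<in> triangle p0 p1 p2 \<and> g i \<omega> \<noteq> p0 \<and> g i \<omega> \<noteq> p2)"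
    using fin by (intro pred_intros_finite pred_intros_logic) measurable
  ultimately show ?thesis
    by (simp only: pred_intros_logic(3))
qed

lemma measurable_longest_chain:
  assumes ne: "p0 \<noteq> p2" and fin: "finite I" "finite Z"
    and g [measurable]: "\<And>i. i \<in> I \<Longrightarrow> g i \<in> borel_measurable N"
  shows "(\<lambda>\<omega>. longest_chain_length p0 p1 p2 (Z \<union> (\<lambda>i. g i \<omega>) ` I)) \<in> measurable N (count_space UNIV)"
proof -
  define h where "h = (\<lambda>i \<omega>. case i of Inl z \<Rightarrow> z | Inr i \<Rightarrow> g i \<omega>)"
  let ?J = "Inl ` Z \<union> Inr ` I"
  have h [measurable]: "h i \<in> borel_measurable N" if "i \<in> ?J" for i
    using that by (auto simp: h_def)
  have eq: "Z \<union> (\<lambda>i. g i \<omega>) ` I = (\<lambda>i. h i \<omega>) ` ?J" for \<omega>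
    by (auto simp: h_def image_Un image_image)
  have J: "finite ?J" using fin by auto
  \<comment> \<open>By heredity, a chain of at least \<open>k\<close> points contains one of exactly
    \<open>k\<close> points. It is named by an index set \<open>K\<close> on which the values are
    distinct, and there are finitely many candidates \<open>K\<close>.\<close>
  have ge: "k \<le> longest_chain_length p0 p1 p2 ((\<lambda>i. h i \<omega>) ` ?J) \<longleftrightarrow>
     (\<exists>K\<in>Pow ?J. card K = k \<and> (\<forall>i\<in>K. \<forall>j\<in>K. i \<noteq> j \<longrightarrow> h i \<omega> \<noteq> h j \<omega>) \<and>
        convex_chain p0 p1 p2 ((\<lambda>i. h i \<omega>) ` K))" (is "?l \<longleftrightarrow> ?r") for k \<omega>
  proof
    assume ?l
    obtain Y where Y: "Y \<subseteq> (\<lambda>i. h i \<omega>) ` ?J" "convex_chain p0 p1 p2 Y"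
        "card Y = longest_chain_length p0 p1 p2 ((\<lambda>i. h i \<omega>) ` ?J)"
      using longest_chain_attained[OF finite_imageI[OF J] ne] by blast
    obtain Y' where Y': "Y' \<subseteq> Y" "card Y' = k"
      using \<open>?l\<close> Y(3) obtain_subset_with_card_n[of k Y] by metis
    have "Y' \<subseteq> (\<lambda>i. h i \<omega>) ` ?J" using Y Y' by blast
    then obtain K where K: "K \<subseteq> ?J" "inj_on (\<lambda>i. h i \<omega>) K" "(\<lambda>i. h i \<omega>) ` K = Y'"
      unfolding subset_image_inj by auto
    then have "card K = k" using Y'(2) card_image by metis
    then show ?r
      using K convex_chain_subset[OF ne Y(2) Y'(1)] by (intro bexI[of _ K]) (auto simp: inj_on_def)
  next
    assume ?r
    then obtain K where K: "K \<subseteq> ?J" "card K = k" "inj_on (\<lambda>i. h i \<omega>) K"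
       "convex_chain p0 p1 p2 ((\<lambda>i. h i \<omega>) ` K)"
      unfolding inj_on_def by blast
    then show ?l
      using card_le_longest_chain[OF finite_imageI[OF J] image_mono[OF K(1)] K(4)]
      by (simp add: card_image)
  qed

  have "Measurable.pred N (\<lambda>\<omega>. k \<le> longest_chain_length p0 p1 p2 ((\<lambda>i. h i \<omega>) ` ?J))" for k
    unfolding ge
  proof (intro pred_intros_finite(4))
    fix K assume K: "K \<in> Pow ?J"
    then have "finite K" using finite_subset[OF _ J] by blast
    have [measurable]: "h i \<in> borel_measurable N" if "i \<in> K" for i
      using K that h by blast
    have "Measurable.pred N (\<lambda>\<omega>. i \<noteq> j \<longrightarrow> h i \<omega> \<noteq> h j \<omega>)" if [simp]: "i \<in> K" "j \<in> K" for i j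
      by measurable
    then have [measurable]: "Measurable.pred N (\<lambda>\<omega>. \<forall>i\<in>K. \<forall>j\<in>K. i \<noteq> j \<longrightarrow> h i \<omega> \<noteq> h j \<omega>)"
      by (intro pred_intros_finite(3) \<open>finite K\<close>)
    have [measurable]: "Measurable.pred N (\<lambda>\<omega>. convex_chain p0 p1 p2 ((\<lambda>i. h i \<omega>) ` K))"
      by (intro measurable_convex_chain ne \<open>finite K\<close>) measurable
    show "Measurable.pred N (\<lambda>\<omega>. card K = k \<and> (\<forall>i\<in>K. \<forall>j\<in>K. i \<noteq> j \<longrightarrow> h i \<omega> \<noteq> h j \<omega>) \<and>
        convex_chain p0 p1 p2 ((\<lambda>i. h i \<omega>) ` K))"
      by measurable
  qed (use J in simp)
  note le [measurable] = this
  have "m = k \<longleftrightarrow> k \<le> m \<and> \<not> Suc k \<le> m" for k m :: nat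
    by auto
  then have eqk: "Measurable.pred N (\<lambda>\<omega>. longest_chain_length p0 p1 p2 ((\<lambda>i. h i \<omega>) ` ?J) = k)" for k
    by (simp only:) (intro pred_intros_logic le)
  show ?thesis
    unfolding eq using eqk
    by (intro measurable_count_space_eq2_countable[THEN iffD2])
      (auto simp: pred_def vimage_def Int_def conj_commute)
qed

section \<open>Expected length as an iterated integral\<close>

text \<open>The expected length of a longest chain in the union of a fixed set \<open>Z\<close> and \<open>n\<close> independent
  points of law \<open>M\<close>. Adding the sample points one at a time lets invariance and
  comparison properties be proved by induction on \<open>n\<close>, for all \<open>Z\<close> simultaneously.\<close>
fun mean_chain :: "real^2 \<Rightarrow> real^2 \<Rightarrow> real^2 \<Rightarrow> (real^2) measure \<Rightarrow> nat \<Rightarrow> (real^2) set \<Rightarrow> ennreal" where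
  "mean_chain p0 p1 p2 M 0 Z = of_nat (longest_chain_length p0 p1 p2 Z)"
| "mean_chain p0 p1 p2 M (Suc n) Z = (\<integral>\<^sup>+y. mean_chain p0 p1 p2 M n (insert y Z) \<partial>M)"

text \<open>The outermost integration variable becomes coordinate \<open>n\<close> of the sample;
  the induction hypothesis treats it as a member of \<open>Z\<close>.\<close>

lemma mean_chain_eq_PiM:
  assumes ne: "p0 \<noteq> p2" and M: "prob_space M" and sets_M [measurable_cong]: "sets M = sets borel"
    and fin: "finite Z"
  shows "mean_chain p0 p1 p2 M n Z =
    (\<integral>\<^sup>+x. of_nat (longest_chain_length p0 p1 p2 (Z \<union> x ` {..<n})) \<partial>(\<Pi>\<^sub>M i\<in>{..<n}. M))"
  using fin
proof (induction n arbitrary: Z)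
  case 0
  then show ?case by (simp add: space_PiM)
next
  case (Suc n)
  interpret prob_space M by (rule M)
  interpret product_sigma_finite "\<lambda>_::nat. M"
    by standard
  have m: "(\<lambda>x. of_nat (longest_chain_length p0 p1 p2 (Z \<union> x ` {..<Suc n})) :: ennreal)
      \<in> borel_measurable (\<Pi>\<^sub>M i\<in>{..<Suc n}. M)"
    by (rule measurable_compose[OF measurable_longest_chain[OF ne _ Suc.prems]]) (auto, measurable)
  have "mean_chain p0 p1 p2 M (Suc n) Z = (\<integral>\<^sup>+y. \<integral>\<^sup>+x. of_nat (longest_chain_length p0 p1 p2
      (insert y Z \<union> x ` {..<n})) \<partial>(\<Pi>\<^sub>M i\<in>{..<n}. M) \<partial>M)"
    using Suc by simp
  also have "\<dots> = (\<integral>\<^sup>+y. \<integral>\<^sup>+x. of_nat (longest_chain_length p0 p1 p2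
      (Z \<union> (x(n := y)) ` {..<Suc n})) \<partial>(\<Pi>\<^sub>M i\<in>{..<n}. M) \<partial>M)"
  proof -
    have "insert y Z \<union> x ` {..<n} = Z \<union> (x(n := y)) ` {..<Suc n}" for x :: "nat \<Rightarrow> real^2" and y
      by (auto simp: lessThan_Suc)
    then show ?thesis by simp
  qed
  also have "\<dots> = (\<integral>\<^sup>+x. of_nat (longest_chain_length p0 p1 p2 (Z \<union> x ` {..<Suc n})) \<partial>(\<Pi>\<^sub>M i\<in>{..<Suc n}. M))"
    unfolding lessThan_Suc
    by (rule product_nn_integral_insert_rev[symmetric]) (use m in \<open>simp_all add: lessThan_Suc\<close>)
  finally show ?case .
qed

text \<open>In the recursion \<open>y\<close> sits below further integrals. Measurability is
  therefore read off the product formula, where it follows from joint measurability in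
  \<open>y\<close> and the remaining sample.\<close>

lemma measurable_mean_chain:
  assumes ne: "p0 \<noteq> p2" and M: "prob_space M" and sets_M [measurable_cong]: "sets M = sets borel"
    and fin: "finite Z"
  shows "(\<lambda>y. mean_chain p0 p1 p2 M n (insert y Z)) \<in> borel_measurable borel"
proof -
  interpret prob_space M by (rule M)
  interpret PiM: prob_space "\<Pi>\<^sub>M i\<in>{..<n}. M"
    by (intro prob_space_PiM M)
  have "(\<lambda>(y, x). of_nat (longest_chain_length p0 p1 p2 (insert y Z \<union> x ` {..<n})) :: ennreal)
      \<in> borel_measurable (borel \<Otimes>\<^sub>M (\<Pi>\<^sub>M i\<in>{..<n}. M))"
  proof -
    let ?g = "\<lambda>i p. case i of None \<Rightarrow> fst p | Some i \<Rightarrow> (snd p :: nat \<Rightarrow> real^2) i"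
    let ?I = "insert None (Some ` {..<n})"
    have [measurable]: "?g i \<in> borel_measurable (borel \<Otimes>\<^sub>M (\<Pi>\<^sub>M i\<in>{..<n}. M))" if "i \<in> ?I" for i
      using that by auto
    have "insert y Z \<union> x ` {..<n} = Z \<union> (\<lambda>i. ?g i (y, x)) ` ?I" for y x
      by (auto simp: image_image)
    then have "(\<lambda>(y, x). of_nat (longest_chain_length p0 p1 p2 (insert y Z \<union> x ` {..<n})) :: ennreal) =
      (\<lambda>p. of_nat (longest_chain_length p0 p1 p2 (Z \<union> (\<lambda>i. ?g i p) ` ?I)))"
      by auto
    then show ?thesis
      by (simp only:) (rule measurable_compose[OF measurable_longest_chain[OF ne _ fin]], auto)
  qed
  then show ?thesis
    unfolding mean_chain_eq_PiM[OF ne M sets_M finite.insertI[OF fin]]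
    by (rule PiM.borel_measurable_nn_integral)
qed

lemma mean_chain_mono_index:
  assumes ne: "p0 \<noteq> p2" and M: "prob_space M" and fin: "finite Z" and "m \<le> n"
  shows "mean_chain p0 p1 p2 M m Z \<le> mean_chain p0 p1 p2 M n Z"
proof -
  interpret prob_space M by (rule M)
  \<comment> \<open>Monotonicity in the starting set compares adding an extra point \<open>y\<close>
    with ignoring it.\<close>
  have *: "mean_chain p0 p1 p2 M n Z \<le> mean_chain p0 p1 p2 M n Z'" if "Z \<subseteq> Z'" "finite Z'" for n Z Z'
    using that
  proof (induction n arbitrary: Z Z')
    case 0
    then show ?case using longest_chain_mono[OF 0(2,1) ne] by simp
  next
    case (Suc n)
    then show ?case by (auto intro!: nn_integral_mono Suc.IH)
  qed
  have "mean_chain p0 p1 p2 M n Z \<le> mean_chain p0 p1 p2 M (Suc n) Z" for n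
  proof -
    have "mean_chain p0 p1 p2 M n Z = (\<integral>\<^sup>+y. mean_chain p0 p1 p2 M n Z \<partial>M)"
      by (simp add: emeasure_space_1)
    also have "\<dots> \<le> (\<integral>\<^sup>+y. mean_chain p0 p1 p2 M n (insert y Z) \<partial>M)"
      using fin by (intro nn_integral_mono *) auto
    finally show ?thesis by simp
  qed
  then show ?thesis
    by (rule lift_Suc_mono_le) fact
qed

text \<open>Provides finiteness, so that the passage to real numbers by \<open>enn2real\<close>
  loses nothing.\<close>

lemma mean_chain_le:
  assumes ne: "p0 \<noteq> p2" and M: "prob_space M" and fin: "finite Z"
  shows "mean_chain p0 p1 p2 M n Z \<le> of_nat (card Z + n)"
  using fin
proof (induction n arbitrary: Z)
  case 0
  then show ?case using longest_chain_le_card[OF _ ne] by simp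
next
  case (Suc n)
  interpret prob_space M by (rule M)
  have "mean_chain p0 p1 p2 M (Suc n) Z \<le> (\<integral>\<^sup>+y. of_nat (card Z + Suc n) \<partial>M)"
    unfolding mean_chain.simps
  proof (intro nn_integral_mono)
    fix y
    have "mean_chain p0 p1 p2 M n (insert y Z) \<le> of_nat (card (insert y Z) + n)"
      using Suc by simp
    also have "\<dots> \<le> of_nat (card Z + Suc n)"
      using Suc.prems by (simp only: of_nat_le_iff) (simp add: card_insert_if)
    finally show "mean_chain p0 p1 p2 M n (insert y Z) \<le> of_nat (card Z + Suc n)" .
  qed
  then show ?case by (simp add: emeasure_space_1)
qed

text \<open>Under \<open>M'\<close> a point hits the triangle with probability \<open>p\<close> and
  then has law \<open>M\<close>; a point that misses is invisible to chains. The number of effective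
  points is thus binomial with weights \<open>Bernstein n j p\<close>, and the induction step is
  Pascal's rule.\<close>

lemma mean_chain_thinning:
  assumes ne: "p0 \<noteq> p2"
    and M: "prob_space M" and sets_M [measurable_cong]: "sets M = sets borel"
    and M': "prob_space M'" and sets_M' [measurable_cong]: "sets M' = sets borel"
    and p: "0 \<le> p" "p \<le> 1"
    and thin: "\<And>S. S \<in> sets borel \<Longrightarrow> emeasure M' (S \<inter> triangle p0 p1 p2) = ennreal p * emeasure M S"
    and fin: "finite Z"
  shows "mean_chain p0 p1 p2 M' n Z = (\<Sum>j\<le>n. ennreal (Bernstein n j p) * mean_chain p0 p1 p2 M j Z)"
  using fin
proof (induction n arbitrary: Z)
  case 0
  then show ?case by (simp add: Bernstein_def)
next
  case (Suc n)
  let ?T = "triangle p0 p1 p2" and ?B = "mean_chain p0 p1 p2 M" and ?B' = "mean_chain p0 p1 p2 M'"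
  interpret M: prob_space M by (rule M)
  interpret M': prob_space M' by (rule M')
  have space [simp]: "space M' = UNIV" "space M = UNIV"
    using sets_eq_imp_space_eq[OF sets_M] sets_eq_imp_space_eq[OF sets_M'] by auto
  \<comment> \<open>The hypothesis on sets identifies two densities as one measure, which transfers
    it to integrals.\<close>
  have thin': "(\<integral>\<^sup>+y. h y * indicator ?T y \<partial>M') = ennreal p * (\<integral>\<^sup>+y. h y \<partial>M)"
    if [measurable]: "h \<in> borel_measurable borel" for h
  proof -
    have "density M' (indicator ?T) = density M (\<lambda>_. ennreal p)"
    proof (rule measure_eqI)
      fix A assume "A \<in> sets (density M' (indicator ?T))"
      then have [measurable]: "A \<in> sets borel" by (simp add: sets_M')
      show "emeasure (density M' (indicator ?T)) A = emeasure (density M (\<lambda>_. ennreal p)) A"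
        using thin[of A] by (simp add: emeasure_density indicator_inter_arith[symmetric] Int_commute
            nn_integral_cmult)
    qed (simp add: sets_M sets_M')
    then have "integral\<^sup>N (density M' (indicator ?T)) h = integral\<^sup>N (density M (\<lambda>_. ennreal p)) h"
      by simp
    then show ?thesis
      by (simp add: nn_integral_density nn_integral_cmult mult.commute)
  qed
  have out: "emeasure M' (- ?T) = ennreal (1 - p)"
  proof -
    have "emeasure M' ?T = ennreal p"
      using thin[of UNIV] M.emeasure_space_1 by simp
    then show ?thesis
      using emeasure_compl[of ?T M'] M'.emeasure_space_1 p
      by (simp add: Compl_eq_Diff_UNIV ennreal_1[symmetric] ennreal_minus del: ennreal_1)
  qed
  have ins: "?B' n (insert y Z) = ?B' n Z" if "y \<notin> ?T" for y n Z
    using that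
  proof (induction n arbitrary: Z)
    case 0
    then show ?case by (simp add: longest_chain_insert_outside)
  next
    case (Suc n)
    then show ?case by (simp add: insert_commute[of _ y])
  qed
  have mB [measurable]: "(\<lambda>y. ?B' n (insert y Z)) \<in> borel_measurable borel"
       "(\<lambda>y. ?B j (insert y Z)) \<in> borel_measurable borel" for j
    using measurable_mean_chain[OF ne M' sets_M' Suc.prems] measurable_mean_chain[OF ne M sets_M Suc.prems]
    by auto
  have "?B' (Suc n) Z = (\<integral>\<^sup>+y. ?B' n (insert y Z) * indicator ?T y + ?B' n Z * indicator (- ?T) y \<partial>M')"
    by (auto intro!: nn_integral_cong simp: ins indicator_def)
  also have "\<dots> = (\<integral>\<^sup>+y. ?B' n (insert y Z) * indicator ?T y \<partial>M') + ?B' n Z * ennreal (1 - p)"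
    by (subst nn_integral_add) (auto simp: nn_integral_cmult out)
  also have "(\<integral>\<^sup>+y. ?B' n (insert y Z) * indicator ?T y \<partial>M') =
      ennreal p * (\<integral>\<^sup>+y. (\<Sum>j\<le>n. ennreal (Bernstein n j p) * ?B j (insert y Z)) \<partial>M)"
    using Suc by (simp add: thin')
  also have "\<dots> = (\<Sum>j\<le>n. ennreal (p * Bernstein n j p) * ?B (Suc j) Z)"
    using p by (simp add: nn_integral_sum nn_integral_cmult sum_distrib_left ennreal_mult
        Bernstein_nonneg mult.assoc)
  also have "?B' n Z * ennreal (1 - p) = (\<Sum>j\<le>n. ennreal ((1 - p) * Bernstein n j p) * ?B j Z)"
    using p Suc by (simp add: sum_distrib_left ennreal_mult Bernstein_nonneg mult_ac)
  also have "(\<Sum>j\<le>n. ennreal (p * Bernstein n j p) * ?B (Suc j) Z) +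
      (\<Sum>j\<le>n. ennreal ((1 - p) * Bernstein n j p) * ?B j Z) =
      (\<Sum>j\<le>Suc n. ennreal (Bernstein (Suc n) j p) * ?B j Z)"
  proof -
    \<comment> \<open>A hit moves weight from index \<open>j\<close> to \<open>j + 1\<close>, a miss
      leaves it at \<open>j\<close>; both sums are brought to the range up to
      \<open>Suc n\<close>.\<close>
    have 1: "(\<Sum>j\<le>n. ennreal (p * Bernstein n j p) * ?B (Suc j) Z) =
        (\<Sum>j\<le>Suc n. ennreal (if j = 0 then 0 else p * Bernstein n (j - 1) p) * ?B j Z)"
      by (subst sum.atMost_Suc_shift) simp
    have 2: "(\<Sum>j\<le>n. ennreal ((1 - p) * Bernstein n j p) * ?B j Z) =
        (\<Sum>j\<le>Suc n. ennreal ((1 - p) * Bernstein n j p) * ?B j Z)"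
    proof -
      have "Bernstein n (Suc n) p = 0" by (simp add: Bernstein_def binomial_eq_0)
      then show ?thesis by simp
    qed
    \<comment> \<open>Pascal's rule, with \<open>j = 0\<close> and \<open>j = Suc n\<close> as
      boundary cases.\<close>
    have 3: "Bernstein (Suc n) j p = (if j = 0 then 0 else p * Bernstein n (j - 1) p) + (1 - p) * Bernstein n j p"
      if "j \<le> Suc n" for j
    proof (cases j)
      case (Suc i)
      show ?thesis
      proof (cases "i < n")
        case True
        then have "n - i = Suc (n - Suc i)" by simp
        then show ?thesis using Suc by (simp add: Bernstein_def algebra_simps)
      qed (use that Suc in \<open>auto simp: Bernstein_def not_less\<close>)
    qed (simp add: Bernstein_def)
    show ?thesis
      unfolding 1 2 sum.distrib[symmetric] using p
      by (intro sum.cong refl) (simp add: 3 Bernstein_nonneg ennreal_plus[symmetric] distrib_right[symmetric]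
         del: ennreal_plus)
  qed
  finally show ?case .
qed

section \<open>Affine invariance\<close>

lemma convex_hull_affine_image:
  "linear B \<Longrightarrow> convex hull ((\<lambda>y. c + B y) ` S) = (\<lambda>y. c + B y) ` (convex hull S)"
  by (metis (no_types, lifting) convex_hull_linear_image convex_hull_translation image_image image_cong)

lemma in_convex_position_affine_image:
  assumes "linear B" "inj B"
  shows "in_convex_position ((\<lambda>y. c + B y) ` S) \<longleftrightarrow> in_convex_position S"
proof -
  have inj: "inj (\<lambda>y. c + B y)"
    using assms(2) by (auto simp: inj_on_def)
  have "(\<lambda>y. c + B y) ` S - {c + B v} = (\<lambda>y. c + B y) ` (S - {v})" for v
    using inj by (auto simp: inj_on_def)
  moreover have "c + B v \<in> (\<lambda>y. c + B y) ` X \<longleftrightarrow> v \<in> X" for v X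
    using inj_image_mem_iff[OF inj, of v X] by simp
  ultimately show ?thesis
    unfolding in_convex_position_def ball_simps by (simp add: convex_hull_affine_image[OF assms(1)])
qed

lemma triangle_affine_image:
  "linear B \<Longrightarrow> triangle (c + B p0) (c + B p1) (c + B p2) = (\<lambda>y. c + B y) ` triangle p0 p1 p2"
  unfolding triangle_def using convex_hull_affine_image[of B c "{p0, p1, p2}"] by simp

lemma convex_chain_affine_image:
  assumes "linear B" "inj B" "p0 \<noteq> p2"
  shows "convex_chain (c + B p0) (c + B p1) (c + B p2) ((\<lambda>y. c + B y) ` Y) \<longleftrightarrow> convex_chain p0 p1 p2 Y"
proof -
  let ?A = "\<lambda>y. c + B y"
  have inj: "inj ?A"
    using assms(2) by (auto simp: inj_on_def)
  have "?A ` Y \<union> {?A p0, ?A p2} = ?A ` (Y \<union> {p0, p2})"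
    by auto
  then have "in_convex_position (?A ` Y \<union> {?A p0, ?A p2}) \<longleftrightarrow> in_convex_position (Y \<union> {p0, p2})"
    by (simp only: in_convex_position_affine_image[OF assms(1,2)])
  then show ?thesis
    using assms inj
    by (simp add: convex_chain_iff inj_eq inj_image_subset_iff triangle_affine_image inj_image_mem_iff[OF inj]
        finite_image_iff inj_on_subset[OF inj])
qed

lemma longest_chain_affine_image:
  assumes "linear B" "inj B" "p0 \<noteq> p2"
  shows "longest_chain_length (c + B p0) (c + B p1) (c + B p2) ((\<lambda>y. c + B y) ` Z) = longest_chain_length p0 p1 p2 Z"
proof -
  let ?A = "\<lambda>y. c + B y"
  have inj: "inj ?A"
    using assms(2) by (auto simp: inj_on_def)
  have "{card Y |Y. Y \<subseteq> ?A ` Z \<and> convex_chain (?A p0) (?A p1) (?A p2) Y} =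
        {card Y |Y. Y \<subseteq> Z \<and> convex_chain p0 p1 p2 Y}" (is "?l = ?r")
  proof (intro equalityI subsetI)
    fix m assume "m \<in> ?l"
    then obtain Y where "Y \<subseteq> ?A ` Z" "m = card Y" "convex_chain (?A p0) (?A p1) (?A p2) Y"
      by blast
    then obtain Y' where "Y' \<subseteq> Z" "Y = ?A ` Y'"
      by (meson subset_imageE)
    then show "m \<in> ?r"
      using \<open>m = card Y\<close> \<open>convex_chain (?A p0) (?A p1) (?A p2) Y\<close> convex_chain_affine_image[OF assms]
        card_image[OF inj_on_subset[OF inj]] by auto
  next
    fix m assume "m \<in> ?r"
    then obtain Y where "Y \<subseteq> Z" "m = card Y" "convex_chain p0 p1 p2 Y"
      by blast
    then show "m \<in> ?l"
      using convex_chain_affine_image[OF assms, of c p1 Y] card_image[OF inj_on_subset[OF inj, of Y]]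
      by (intro CollectI exI[of _ "?A ` Y"]) auto
  qed
  then show ?thesis by (simp add: longest_chain_length_def)
qed

lemma borel_measurable_affine:
  fixes B :: "real^2 \<Rightarrow> real^2"
  shows "linear B \<Longrightarrow> (\<lambda>y. c + B y) \<in> borel_measurable borel"
  by (intro borel_measurable_continuous_onI continuous_intros linear_continuous_on linear_conv_bounded_linear[THEN iffD1])

text \<open>A new point of the image sample is the image of a new point of the original sample, and
  each joins its own copy of \<open>Z\<close>; the arbitrary \<open>Z\<close> makes this an
  induction.\<close>

lemma mean_chain_affine:
  assumes B: "linear B" "inj B" and ne: "p0 \<noteq> p2"
    and M: "prob_space M" and sets_M [measurable_cong]: "sets M = sets borel" and fin: "finite Z"
  shows "mean_chain (c + B p0) (c + B p1) (c + B p2) (distr M borel (\<lambda>y. c + B y)) n ((\<lambda>y. c + B y) ` Z) =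
    mean_chain p0 p1 p2 M n Z"
  using fin
proof (induction n arbitrary: Z)
  case 0
  then show ?case by (simp add: longest_chain_affine_image[OF B ne])
next
  case (Suc n)
  let ?A = "\<lambda>y. c + B y"
  have [measurable]: "?A \<in> borel_measurable M"
    using borel_measurable_affine[OF B(1)] by simp
  have "?A p0 \<noteq> ?A p2" using B(2) ne by (auto simp: inj_eq)
  then have "(\<lambda>y. mean_chain (?A p0) (?A p1) (?A p2) (distr M borel ?A) n (insert y (?A ` Z)))
     \<in> borel_measurable borel"
    by (intro measurable_mean_chain prob_space.prob_space_distr M finite_imageI Suc.prems) auto
  then show ?case
    using Suc.IH[of "insert _ Z"] Suc.prems by (simp add: nn_integral_distr)
qed

lemma emeasure_lborel_affine_image:
  fixes B :: "real^2 \<Rightarrow> real^2"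
  assumes B: "linear B" "inj B" and S: "S \<in> sets borel" "bounded S"
  shows "(\<lambda>y. c + B y) ` S \<in> sets borel"
    and "emeasure lborel ((\<lambda>y. c + B y) ` S) = ennreal \<bar>det (matrix B)\<bar> * emeasure lborel S"
proof -
  obtain B' where B': "linear B'" "\<And>x. B' (B x) = x" "\<And>x. B (B' x) = x"
    using linear_injective_isomorphism[OF B] by blast
  \<comment> \<open>The image of \<open>S\<close> is its preimage under the inverse affine map,
    hence Borel.\<close>
  have "(\<lambda>y. B' (- c) + B' y) \<in> borel_measurable borel"
    by (rule borel_measurable_affine[OF B'(1)])
  then have "(\<lambda>y. B' (- c) + B' y) -` S \<inter> space borel \<in> sets borel"
    by (rule measurable_sets) (rule S)
  moreover have "(\<lambda>y. B' (- c) + B' y) -` S \<inter> space borel = (\<lambda>y. c + B y) ` S"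
  proof -
    have 1: "B' (- c) + B' y = B' (y - c)" for y
      by (simp add: linear_add[OF B'(1), symmetric])
    show ?thesis
      unfolding 1 using B' by (auto simp: image_iff) (metis add.commute diff_add_cancel)
  qed
  ultimately show bor: "(\<lambda>y. c + B y) ` S \<in> sets borel" by simp
  have S': "S \<in> lmeasurable"
    using S by (intro bounded_set_imp_lmeasurable) auto
  have im: "(\<lambda>y. c + B y) ` S = (+) c ` (B ` S)"
    by (simp add: image_image)
  have "(\<lambda>y. c + B y) ` S \<in> lmeasurable"
    unfolding im by (intro measurable_translation measurable_linear_image B S')
  then have "emeasure lebesgue ((\<lambda>y. c + B y) ` S) = ennreal (measure lebesgue ((\<lambda>y. c + B y) ` S))"
    by (simp add: emeasure_eq_measure2 fmeasurableD2)
  also have "measure lebesgue ((\<lambda>y. c + B y) ` S) = \<bar>det (matrix B)\<bar> * measure lebesgue S"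
    unfolding im measure_translation by (rule measure_linear_image[OF B(1) S'])
  also have "ennreal \<dots> = ennreal \<bar>det (matrix B)\<bar> * emeasure lebesgue S"
    using S' by (simp add: ennreal_mult emeasure_eq_measure2 fmeasurableD2)
  finally show "emeasure lborel ((\<lambda>y. c + B y) ` S) = ennreal \<bar>det (matrix B)\<bar> * emeasure lborel S"
    using bor S(1) by simp
qed

section \<open>The reference triangle\<close>

abbreviation unit_triangle :: "(real^2) set" where
  "unit_triangle \<equiv> triangle (vector [0, 1]) (vector [1, 0]) 0"

lemma vec2_eq_iff: "(x::real^2) = y \<longleftrightarrow> x $ 1 = y $ 1 \<and> x $ 2 = y $ 2"
  by (auto simp: vec_eq_iff forall_2)

lemma mem_unit_triangle: "x \<in> unit_triangle \<longleftrightarrow> 0 \<le> x $ 1 \<and> 0 \<le> x $ 2 \<and> x $ 1 + x $ 2 \<le> 1"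
proof
  assume "x \<in> unit_triangle"
  then show "0 \<le> x $ 1 \<and> 0 \<le> x $ 2 \<and> x $ 1 + x $ 2 \<le> 1"
    by (auto simp: triangle_def convex_hull_3)
next
  assume "0 \<le> x $ 1 \<and> 0 \<le> x $ 2 \<and> x $ 1 + x $ 2 \<le> 1"
  then show "x \<in> unit_triangle"
    unfolding triangle_def convex_hull_3
    by (intro CollectI exI[of _ "x $ 2"] exI[of _ "x $ 1"] exI[of _ "1 - x $ 1 - x $ 2"])
      (auto simp: vec2_eq_iff)
qed

lemma noncollinear_affine_unit:
  fixes p0 p1 p2 :: "real^2"
  assumes "\<not> collinear {p0, p1, p2}"
  obtains c :: "real^2" and B :: "real^2 \<Rightarrow> real^2"
    where "linear B" "inj B" "p0 = c + B (vector [0, 1])" "p1 = c + B (vector [1, 0])" "p2 = c + B 0"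
proof -
  let ?B = "\<lambda>y::real^2. y $ 1 *\<^sub>R (p1 - p2) + y $ 2 *\<^sub>R (p0 - p2)"
  have lin: "linear ?B"
    by (auto intro!: linearI simp: algebra_simps)
  have nc: "\<not> collinear {0, p0 - p2, p1 - p2}"
    using assms collinear_3[of p0 p2 p1] by (simp add: insert_commute NO_MATCH_def)
  have "y = 0" if "?B y = 0" for y
  proof -
    have "y $ 1 = 0"
    proof (rule ccontr)
      assume "y $ 1 \<noteq> 0"
      have "p1 - p2 = (- y $ 2 / y $ 1) *\<^sub>R (p0 - p2)"
      proof -
        have "(y $ 1) *\<^sub>R (p1 - p2) = (y $ 1) *\<^sub>R ((- y $ 2 / y $ 1) *\<^sub>R (p0 - p2))"
          using that \<open>y $ 1 \<noteq> 0\<close> by (simp add: add_eq_0_iff2)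
        then show ?thesis
          using \<open>y $ 1 \<noteq> 0\<close> by (simp only: scaleR_cancel_left) simp
      qed
      then show False
        using nc unfolding collinear_lemma by blast
    qed
    moreover have "p0 \<noteq> p2" using nc by auto
    ultimately show ?thesis
      using that by (auto simp: vec2_eq_iff)
  qed
  then have "inj ?B"
    using linear_injective_0[OF lin] by blast
  then show ?thesis
    by (rule that[OF lin, of p2]) auto
qed

lemma Basis_vec2: "(Basis :: (real^2) set) = {axis 1 1, axis 2 1}" "axis 1 1 \<noteq> (axis 2 1 :: real^2)"
  by (auto simp: Basis_vec_def UNIV_2) (simp add: vec2_eq_iff axis_def)

text \<open>A box inside the unit triangle replaces the computation of its area. The bound
  \<open>1 / 4\<close> yields positivity here, the density constant 4 in the upper bound, and later
  a set of points that each form a chain.\<close>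

lemma emeasure_half_box: "emeasure lborel (box 0 (vector [1/2, 1/2]) :: (real^2) set) = ennreal (1 / 4)"
  unfolding emeasure_lborel_box_eq Basis_vec2(1) using Basis_vec2(2) by (simp add: inner_axis)

lemma half_box_subset: "box 0 (vector [1/2, 1/2]) \<subseteq> unit_triangle"
  by (auto simp: mem_unit_triangle mem_box_cart forall_2)

lemma emeasure_unit_triangle_ge: "ennreal (1 / 4) \<le> emeasure lborel unit_triangle"
  unfolding emeasure_half_box[symmetric] by (intro emeasure_mono half_box_subset) auto

lemma emeasure_unit_triangle_pos: "emeasure lborel unit_triangle > 0"
  using emeasure_unit_triangle_ge by (rule order_less_le_trans[rotated]) simp

lemma emeasure_triangle_pos:
  assumes "\<not> collinear {p0, p1, p2}"
  shows "emeasure lborel (triangle p0 p1 p2) > 0" "emeasure lborel (triangle p0 p1 p2) < \<infinity>"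
proof -
  obtain c and B :: "real^2 \<Rightarrow> real^2" where B: "linear B" "inj B" and p: "p0 = c + B (vector [0, 1])" "p1 = c + B (vector [1, 0])" "p2 = c + B 0"
    using noncollinear_affine_unit[OF assms] by blast
  have "det (matrix B) \<noteq> 0"
    using B det_nz_iff_inj by blast
  then show "emeasure lborel (triangle p0 p1 p2) > 0"
    unfolding p triangle_affine_image[OF B(1)]
    using emeasure_lborel_affine_image(2)[OF B borel_triangle bounded_triangle] emeasure_unit_triangle_pos
    by (simp add: ennreal_zero_less_mult_iff)
  show "emeasure lborel (triangle p0 p1 p2) < \<infinity>"
    using bounded_triangle emeasure_bounded_finite by blast
qed

section \<open>Uniform laws on triangles\<close>

abbreviation uniform_triangle :: "real^2 \<Rightarrow> real^2 \<Rightarrow> real^2 \<Rightarrow> (real^2) measure" where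
  "uniform_triangle p0 p1 p2 \<equiv> uniform_measure lborel (triangle p0 p1 p2)"

lemma prob_space_uniform_triangle:
  "\<not> collinear {p0, p1, p2} \<Longrightarrow> prob_space (uniform_triangle p0 p1 p2)"
  using emeasure_triangle_pos by (intro prob_space_uniform_measure) (auto simp: less_le)

text \<open>The factor \<open>\<bar>det (matrix B)\<bar>\<close> scales the set and the triangle
  alike and cancels in the quotient.\<close>

lemma distr_uniform_triangle:
  assumes nc: "\<not> collinear {p0, p1, p2}" and B: "linear B" "inj B"
  shows "distr (uniform_triangle p0 p1 p2) borel (\<lambda>y. c + B y) = uniform_triangle (c + B p0) (c + B p1) (c + B p2)"
proof (rule measure_eqI)
  let ?A = "\<lambda>y. c + B y" and ?T = "triangle p0 p1 p2"
  have [measurable]: "?A \<in> borel_measurable borel"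
    by (rule borel_measurable_affine[OF B(1)])
  have d: "det (matrix B) \<noteq> 0"
    using B det_nz_iff_inj by blast
  fix S assume "S \<in> sets (distr (uniform_triangle p0 p1 p2) borel ?A)"
  then have [measurable]: "S \<in> sets borel" by simp
  have pre [measurable]: "?A -` S \<in> sets borel"
    using measurable_sets[of ?A borel borel S] by simp
  have "?A ` (?T \<inter> ?A -` S) = ?A ` ?T \<inter> S" by auto
  then have "emeasure lborel (?A ` ?T \<inter> S) = ennreal \<bar>det (matrix B)\<bar> * emeasure lborel (?T \<inter> ?A -` S)"
    using emeasure_lborel_affine_image(2)[OF B, of "?T \<inter> ?A -` S" c] bounded_triangle[of p0 p1 p2]
    by (simp add: bounded_Int)
  moreover have "emeasure lborel (?A ` ?T) = ennreal \<bar>det (matrix B)\<bar> * emeasure lborel ?T"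
    by (rule emeasure_lborel_affine_image(2)[OF B borel_triangle bounded_triangle])
  ultimately show "emeasure (distr (uniform_triangle p0 p1 p2) borel ?A) S =
     emeasure (uniform_triangle (?A p0) (?A p1) (?A p2)) S"
    using d emeasure_triangle_pos[OF nc] emeasure_lborel_affine_image(1)[OF B borel_triangle bounded_triangle]
    by (simp add: emeasure_distr triangle_affine_image[OF B(1)] divide_mult_eq mult.commute[of "ennreal _"])
qed simp

text \<open>The \<open>f n\<close> of the overview. The reference triangle has vertices
  \<open>(a, b)\<close>, \<open>(u, 0)\<close>, \<open>(0, 0)\<close> with \<open>a = 0\<close> and
  \<open>b = u = 1\<close>, the form in which chains are peeled in the upper bound.\<close>

definition mean_longest_chain :: "nat \<Rightarrow> real" where
  "mean_longest_chain n = enn2real (mean_chain (vector [0, 1]) (vector [1, 0]) 0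
     (uniform_triangle (vector [0, 1]) (vector [1, 0]) 0) n {})"

lemma noncollinear_unit_triangle: "\<not> collinear {vector [0, 1], vector [1, 0], 0 :: real^2}"
proof -
  have "\<not> collinear {0, vector [0, 1], vector [1, 0] :: real^2}"
    unfolding collinear_lemma by (auto simp: vec2_eq_iff)
  then show ?thesis by (simp add: insert_commute)
qed

lemma mean_chain_triangle:
  assumes nc: "\<not> collinear {p0, p1, p2}"
  shows "mean_chain p0 p1 p2 (uniform_triangle p0 p1 p2) n {} = ennreal (mean_longest_chain n)"
proof -
  obtain c and B :: "real^2 \<Rightarrow> real^2" where B: "linear B" "inj B" and p: "p0 = c + B (vector [0, 1])" "p1 = c + B (vector [1, 0])" "p2 = c + B 0"
    using noncollinear_affine_unit[OF nc] by blast
  let ?M = "uniform_triangle (vector [0, 1]) (vector [1, 0]) 0"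
  have ne: "vector [0, 1] \<noteq> (0 :: real^2)" by (simp add: vec2_eq_iff)
  have M: "prob_space ?M" by (rule prob_space_uniform_triangle[OF noncollinear_unit_triangle])
  have "mean_chain (vector [0, 1]) (vector [1, 0]) 0 ?M n {} < \<top>"
    using mean_chain_le[OF ne M, of "{}" "vector [1, 0]" n]
    by (rule order_le_less_trans[OF _ of_nat_less_top]) simp
  then show ?thesis
    unfolding p distr_uniform_triangle[OF noncollinear_unit_triangle B, symmetric] mean_longest_chain_def
    using mean_chain_affine[OF B ne M, of "{}" c "vector [1, 0]" n] by simp
qed

lemma expected_longest_chain_eq:
  assumes nc: "\<not> collinear {p0, p1, p2}"
  shows "expected_longest_chain p0 p1 p2 n = mean_longest_chain n"
proof -
  have ne: "p0 \<noteq> p2" using nc by (auto simp: insert_commute)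
  note M = prob_space_uniform_triangle[OF nc]
  have "(\<lambda>x. longest_chain_length p0 p1 p2 ({} \<union> (\<lambda>i. x i) ` {..<n}))
     \<in> sample_measure p0 p1 p2 n \<rightarrow>\<^sub>M count_space UNIV"
    by (rule measurable_longest_chain[OF ne]) (auto simp: sample_measure_def, measurable)
  then have "expected_longest_chain p0 p1 p2 n =
     enn2real (\<integral>\<^sup>+x. of_nat (longest_chain_length p0 p1 p2 ({} \<union> x ` {..<n})) \<partial>sample_measure p0 p1 p2 n)"
    unfolding expected_longest_chain_def
    by (subst integral_eq_nn_integral) (auto simp: ennreal_of_nat_eq_real_of_nat)
  also have "\<dots> = enn2real (mean_chain p0 p1 p2 (uniform_triangle p0 p1 p2) n {})"
    unfolding sample_measure_def by (subst mean_chain_eq_PiM[OF ne M]) auto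
  also have "\<dots> = mean_longest_chain n"
    unfolding mean_chain_triangle[OF nc] by (simp add: mean_longest_chain_def)
  finally show ?thesis .
qed

section \<open>Superadditivity along a parabola\<close>

text \<open>The triangle cut off by the tangents of the parabola \<open>y = x\<^sup>2\<close> at \<open>(0, 0)\<close> and \<open>(1, 1)\<close>.
  The map \<open>parabola_map k i\<close> sends the parabola to itself and \<open>0 \<le> x \<le> 1\<close> to
  \<open>i / k \<le> x \<le> (i + 1) / k\<close>.\<close>

abbreviation tangent_apex :: "real^2" where "tangent_apex \<equiv> vector [1/2, 0]"
abbreviation parabola_end :: "real^2" where "parabola_end \<equiv> vector [1, 1]"

text \<open>Linear part and base point are kept apart because the affine lemmas speak of maps
  \<open>c + B y\<close>.\<close>

definition parabola_lin :: "nat \<Rightarrow> nat \<Rightarrow> real^2 \<Rightarrow> real^2" where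
  "parabola_lin k i y = vector [y $ 1 / real k, (2 * real i * y $ 1 + y $ 2) / (real k)\<^sup>2]"

definition parabola_pt :: "nat \<Rightarrow> nat \<Rightarrow> real^2" where
  "parabola_pt k i = vector [real i / real k, (real i)\<^sup>2 / (real k)\<^sup>2]"

definition parabola_map :: "nat \<Rightarrow> nat \<Rightarrow> real^2 \<Rightarrow> real^2" where
  "parabola_map k i y = parabola_pt k i + parabola_lin k i y"

lemma parabola_map_nth:
  "parabola_map k i y $ 1 = (real i + y $ 1) / real k"
  "parabola_map k i y $ 2 = ((real i)\<^sup>2 + 2 * real i * y $ 1 + y $ 2) / (real k)\<^sup>2"
  by (simp_all add: parabola_map_def parabola_lin_def parabola_pt_def add_divide_distrib)

lemma linear_parabola_lin: "linear (parabola_lin k i)"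
  by (rule linearI) (simp_all add: parabola_lin_def vec2_eq_iff add_divide_distrib algebra_simps)

lemma inj_parabola_lin: "k > 0 \<Longrightarrow> inj (parabola_lin k i)"
  by (rule injI) (auto simp: parabola_lin_def vec2_eq_iff)

lemma inj_parabola_map: "k > 0 \<Longrightarrow> inj (parabola_map k i)"
  using inj_parabola_lin[of k i] by (simp add: parabola_map_def inj_def)

text \<open>The matrix is triangular with diagonal \<open>1 / k\<close>, \<open>1 / k^2\<close>.
  This area ratio is the origin of the exponent \<open>1/3\<close>: a factor \<open>k\<close> in
  length costs \<open>k^3\<close> in sample size.\<close>

lemma det_parabola_lin: "k > 0 \<Longrightarrow> det (matrix (parabola_lin k i)) = 1 / real k ^ 3"
  by (simp add: det_2 matrix_def parabola_lin_def axis_def power2_eq_square power3_eq_cube)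

text \<open>The three sides in order: the tangent at the origin, the tangent at
  \<open>(1, 1)\<close>, and the chord.\<close>

lemma mem_tangent_triangle:
  "x \<in> triangle 0 tangent_apex parabola_end \<longleftrightarrow> 0 \<le> x $ 2 \<and> 2 * x $ 1 - 1 \<le> x $ 2 \<and> x $ 2 \<le> x $ 1"
proof
  assume "x \<in> triangle 0 tangent_apex parabola_end"
  then show "0 \<le> x $ 2 \<and> 2 * x $ 1 - 1 \<le> x $ 2 \<and> x $ 2 \<le> x $ 1"
    by (auto simp: triangle_def convex_hull_3)
next
  assume "0 \<le> x $ 2 \<and> 2 * x $ 1 - 1 \<le> x $ 2 \<and> x $ 2 \<le> x $ 1"
  then show "x \<in> triangle 0 tangent_apex parabola_end"
    unfolding triangle_def convex_hull_3
    by (rule_tac CollectI, rule_tac x="1 - 2 * x $ 1 + x $ 2" in exI, rule_tac x="2 * (x $ 1 - x $ 2)" in exI,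
        rule_tac x="x $ 2" in exI) (auto simp: vec2_eq_iff diff_divide_distrib)
qed

lemma noncollinear_tangent_triangle: "\<not> collinear {0, tangent_apex, parabola_end}"
  unfolding collinear_lemma by (auto simp: vec2_eq_iff)

lemma inner_vec2: "x \<bullet> (y::real^2) = x $ 1 * y $ 1 + x $ 2 * y $ 2"
  by (simp add: inner_vec_def sum_2)

lemma tangent_triangle_x:
  assumes "x \<in> triangle 0 tangent_apex parabola_end"
  shows "0 \<le> x $ 1" "x $ 1 \<le> 1" "x \<noteq> 0 \<Longrightarrow> 0 < x $ 1" "x \<noteq> parabola_end \<Longrightarrow> x $ 1 < 1"
  using assms by (auto simp: mem_tangent_triangle vec2_eq_iff)

text \<open>A chain vertex is strictly separated from the other points. Lying below the chord, it
  must be separated from below, so the separating line is not vertical; lying above both tangents,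
  it forces a slope between those of the tangents, 0 and 2.\<close>

lemma chain_supporting_slope:
  assumes ch: "convex_chain 0 tangent_apex parabola_end Y" and y: "y \<in> Y"
  obtains s where "0 < s" "s < 2"
    "\<And>z. z \<in> Y \<union> {0, parabola_end} \<Longrightarrow> z \<noteq> y \<Longrightarrow> s * (z $ 1 - y $ 1) < z $ 2 - y $ 2"
proof -
  have ne: "0 \<noteq> parabola_end" by (simp add: vec2_eq_iff)
  have c: "finite Y" "Y \<subseteq> triangle 0 tangent_apex parabola_end" "y \<noteq> 0" "y \<noteq> parabola_end"
    "in_convex_position (Y \<union> {0, parabola_end})"
    using ch y by (auto simp: convex_chain_iff[OF ne])
  then have "y \<notin> convex hull (Y \<union> {0, parabola_end} - {y})"
    using y unfolding in_convex_position_def by blast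
  then obtain d where d: "\<And>z. z \<in> Y \<union> {0, parabola_end} \<Longrightarrow> z \<noteq> y \<Longrightarrow> d \<bullet> y < d \<bullet> z"
    using not_in_convex_hull_finite_iff[of "Y \<union> {0, parabola_end} - {y}" y] c(1) by auto
  have yT: "y \<in> triangle 0 tangent_apex parabola_end" using c y by blast
  note x = tangent_triangle_x[OF yT]
  have d0: "d $ 1 * y $ 1 + d $ 2 * y $ 2 < 0"
    using d[of 0] c by (simp add: inner_vec2)
  have d1: "d $ 1 * y $ 1 + d $ 2 * y $ 2 < d $ 1 + d $ 2"
    using d[of parabola_end] c by (simp add: inner_vec2)
  \<comment> \<open>The separation inequalities for \<open>0\<close> and
    \<open>parabola_end\<close>, averaged with weights \<open>1 - y $ 1\<close> and
    \<open>y $ 1\<close>, compare \<open>y\<close> with the chord point above it; the first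
    coordinates cancel.\<close>
  have "(1 - y $ 1) * (d $ 1 * y $ 1 + d $ 2 * y $ 2) + y $ 1 * (d $ 1 * y $ 1 + d $ 2 * y $ 2) < y $ 1 * (d $ 1 + d $ 2)"
  proof -
    have "y $ 1 * (d $ 1 * y $ 1 + d $ 2 * y $ 2) < y $ 1 * (d $ 1 + d $ 2)"
      using d1 x(3) c(3) by simp
    moreover have "(1 - y $ 1) * (d $ 1 * y $ 1 + d $ 2 * y $ 2) \<le> 0"
      using d0 x(2) by (intro mult_nonneg_nonpos) auto
    ultimately show ?thesis by linarith
  qed
  then have "0 < d $ 2 * (y $ 1 - y $ 2)"
    by (simp add: algebra_simps)
  then have d2: "d $ 2 > 0"
    using yT by (auto simp: mem_tangent_triangle zero_less_mult_iff)
  define s where "s = - d $ 1 / d $ 2"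
  have s: "s * (z $ 1 - y $ 1) < z $ 2 - y $ 2" if "z \<in> Y \<union> {0, parabola_end}" "z \<noteq> y" for z
    using d[OF that] d2 by (simp add: s_def inner_vec2 field_simps)
  have "0 < s * y $ 1"
    using s[of 0] c(3) yT by (simp add: mem_tangent_triangle)
  then have "0 < s" using x(1) by (auto simp: zero_less_mult_iff)
  moreover have "s * (1 - y $ 1) < 2 * (1 - y $ 1)"
    using s[of parabola_end] c(4) yT by (simp add: mem_tangent_triangle)
  then have "0 < (2 - s) * (1 - y $ 1)"
    by (simp add: algebra_simps)
  then have "s < 2" using x(2) by (auto simp: zero_less_mult_iff)
  ultimately show ?thesis using s that by blast
qed

text \<open>\<open>2 m / k\<close> is the slope of the parabola at \<open>m / k\<close>. A triangle
  bounded by an arc's chord and end tangents stays above every other tangent touching outside the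
  open arc, and the arc from \<open>j / k\<close> to \<open>(j + 1) / k\<close> has no grid point in
  its interior.\<close>

lemma parabola_map_above_tangent:
  assumes z: "z \<in> triangle 0 tangent_apex parabola_end" and "k > 0"
  shows "2 * real m / real k * (parabola_map k j z $ 1 - real m / real k) \<le>
    parabola_map k j z $ 2 - (real m)\<^sup>2 / (real k)\<^sup>2"
proof -
  have "0 \<le> (real j - real m)\<^sup>2 + 2 * (real j - real m) * z $ 1 + z $ 2"
  proof (cases "m \<le> j")
    case True
    then have "0 \<le> 2 * (real j - real m) * z $ 1"
      using tangent_triangle_x[OF z] by simp
    then show ?thesis
      using z by (simp add: mem_tangent_triangle add_nonneg_nonneg)
  next
    case False
    then have e: "1 \<le> real m - real j" by linarith
    \<comment> \<open>This product is the goal with \<open>z $ 2\<close> replaced by its lower bound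
      \<open>2 * z $ 1 - 1\<close>; both factors are nonnegative since \<open>m - j\<close> is at
      least 1 and \<open>z $ 1 \<le> 1\<close>.\<close>
    have "0 \<le> (real m - real j - 1) * (real m - real j + 1 - 2 * z $ 1)"
      using e tangent_triangle_x[OF z] by simp
    moreover have "2 * z $ 1 - 1 \<le> z $ 2"
      using z by (simp add: mem_tangent_triangle)
    ultimately show ?thesis
      by (simp add: power2_eq_square algebra_simps)
  qed
  then have "2 * real m * (real j + z $ 1 - real m) \<le> (real j)\<^sup>2 + 2 * real j * z $ 1 + z $ 2 - (real m)\<^sup>2"
    by (simp add: power2_eq_square algebra_simps)
  then have "2 * real m * (real j + z $ 1 - real m) / (real k)\<^sup>2 \<le>
     ((real j)\<^sup>2 + 2 * real j * z $ 1 + z $ 2 - (real m)\<^sup>2) / (real k)\<^sup>2"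
    by (rule divide_right_mono) simp
  then show ?thesis
    by (simp add: parabola_map_nth power2_eq_square diff_divide_distrib add_divide_distrib algebra_simps)
qed

text \<open>The map preserves the upward vertical direction and turns slope \<open>s\<close> into
  \<open>(2 i + s) / k\<close>, so supporting lines from below stay supporting.\<close>

lemma parabola_map_slope:
  assumes "k > 0" "s * (z $ 1 - y $ 1) < z $ 2 - y $ 2"
  shows "(2 * real i + s) / real k * (parabola_map k i z $ 1 - parabola_map k i y $ 1) <
    parabola_map k i z $ 2 - parabola_map k i y $ 2"
proof -
  have "(2 * real i + s) / real k * (parabola_map k i z $ 1 - parabola_map k i y $ 1) =
      (2 * real i * (z $ 1 - y $ 1) + s * (z $ 1 - y $ 1)) / (real k)\<^sup>2"
    by (simp add: parabola_map_nth power2_eq_square diff_divide_distrib[symmetric] algebra_simps)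
  also have "\<dots> < (2 * real i * (z $ 1 - y $ 1) + (z $ 2 - y $ 2)) / (real k)\<^sup>2"
    using assms by (intro divide_strict_right_mono) auto
  also have "\<dots> = parabola_map k i z $ 2 - parabola_map k i y $ 2"
    by (simp add: parabola_map_nth diff_divide_distrib[symmetric] algebra_simps)
  finally show ?thesis .
qed

lemma parabola_map_triangle_subset:
  assumes "i < k" and z: "z \<in> triangle 0 tangent_apex parabola_end"
  shows "parabola_map k i z \<in> triangle 0 tangent_apex parabola_end"
proof -
  have k: "k > 0" using assms by simp
  note x = tangent_triangle_x[OF z]
  have "0 \<le> parabola_map k i z $ 2"
    using z x by (simp add: parabola_map_nth mem_tangent_triangle)
  moreover have "2 * parabola_map k i z $ 1 - 1 \<le> parabola_map k i z $ 2"
    using parabola_map_above_tangent[OF z k, of k i] k by simp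
  moreover have "parabola_map k i z $ 2 \<le> parabola_map k i z $ 1"
  proof -
    have "(real i)\<^sup>2 + 2 * real i * z $ 1 + z $ 2 \<le> (real i + 1) * (real i + z $ 1)"
    proof -
      have "real i * z $ 1 \<le> real i" using x(2) by (simp add: mult_left_le)
      then show ?thesis
        using z by (simp add: mem_tangent_triangle power2_eq_square algebra_simps)
    qed
    also have "\<dots> \<le> real k * (real i + z $ 1)"
      using assms x by (intro mult_right_mono) auto
    finally have "((real i)\<^sup>2 + 2 * real i * z $ 1 + z $ 2) / (real k)\<^sup>2 \<le> real k * (real i + z $ 1) / (real k)\<^sup>2"
      by (rule divide_right_mono) simp
    then show ?thesis
      using k by (simp add: parabola_map_nth power2_eq_square)
  qed
  ultimately show ?thesis by (simp add: mem_tangent_triangle)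
qed

text \<open>A supporting line at a point of the \<open>i\<close>-th chain runs strictly below the
  parabola points at \<open>i / k\<close> and \<open>(i + 1) / k\<close>, with slope between the
  slopes there. To the left of the first and to the right of the second it stays below the
  respective tangent, which in turn is below the other pieces.\<close>

lemma parabola_map_chains_union:
  assumes k: "k > 0" and ch: "\<And>i. i < k \<Longrightarrow> convex_chain 0 tangent_apex parabola_end (Y i)"
  shows "convex_chain 0 tangent_apex parabola_end (\<Union>i<k. parabola_map k i ` Y i)"
    and "card (\<Union>i<k. parabola_map k i ` Y i) = (\<Sum>i<k. card (Y i))"
proof -
  let ?T = "triangle 0 tangent_apex parabola_end"
  let ?U = "\<Union>i<k. parabola_map k i ` Y i"
  have ne: "0 \<noteq> parabola_end" by (simp add: vec2_eq_iff)
  have Y: "finite (Y i)" "Y i \<subseteq> ?T" "0 \<notin> Y i" "parabola_end \<notin> Y i" if "i < k" for i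
    using ch[OF that] by (auto simp: convex_chain_iff[OF ne])
  have pT: "0 \<in> ?T" "parabola_end \<in> ?T" by (auto simp: mem_tangent_triangle)
  have strict: "real i / real k < parabola_map k i y $ 1" "parabola_map k i y $ 1 < real (Suc i) / real k"
    if "i < k" "y \<in> Y i" for i y
    using tangent_triangle_x[of y] Y[OF that(1)] that k
    by (auto simp: parabola_map_nth divide_simps)
  have fin: "finite ?U" using Y by auto
  have UT: "?U \<subseteq> ?T" using Y(2) parabola_map_triangle_subset by blast
  have out: "0 \<notin> ?U" "parabola_end \<notin> ?U"
  proof -
    show "0 \<notin> ?U"
    proof
      assume "0 \<in> ?U"
      then obtain i y where "i < k" "y \<in> Y i" "0 = parabola_map k i y" by blast
      then show False
        using strict(1)[of i y] by (simp add: divide_simps split: if_splits)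
    qed
    show "parabola_end \<notin> ?U"
    proof
      assume "parabola_end \<in> ?U"
      then obtain i y where iy: "i < k" "y \<in> Y i" "parabola_end = parabola_map k i y" by blast
      then have "parabola_map k i y $ 1 = 1" by (metis vector_2(1))
      then show False
        using strict(2)[of i y] iy k by (simp add: field_simps)
    qed
  qed
  have support: "\<exists>d. \<forall>w \<in> ?U \<union> {0, parabola_end} - {v}. d \<bullet> v < d \<bullet> w" if v: "v \<in> ?U \<union> {0, parabola_end}" for v
  proof -
    consider "v = 0" | "v = parabola_end" | i y where "i < k" "y \<in> Y i" "v = parabola_map k i y"
      using v by blast
    then show ?thesis
    proof cases
      case 1
      \<comment> \<open>The two endpoints are exposed by vertical lines: they alone have extreme
        first coordinates.\<close>
      have "vector [1, 0] \<bullet> v < vector [1, 0] \<bullet> w" if "w \<in> ?U \<union> {0, parabola_end} - {v}" for w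
        using that 1 tangent_triangle_x[of w] UT pT by (auto simp: inner_vec2)
      then show ?thesis by blast
    next
      case 2
      have "vector [-1, 0] \<bullet> v < vector [-1, 0] \<bullet> w" if "w \<in> ?U \<union> {0, parabola_end} - {v}" for w
        using that 2 tangent_triangle_x[of w] UT pT by (auto simp: inner_vec2)
      then show ?thesis by blast
    next
      case 3
      obtain s where s: "0 < s" "s < 2"
        "\<And>z. z \<in> Y i \<union> {0, parabola_end} \<Longrightarrow> z \<noteq> y \<Longrightarrow> s * (z $ 1 - y $ 1) < z $ 2 - y $ 2"
        using chain_supporting_slope[OF ch[OF 3(1)] 3(2)] by blast
      define S where "S = (2 * real i + s) / real k"
      have S: "2 * real i / real k \<le> S" "S \<le> 2 * real (Suc i) / real k"
        using s k by (auto simp: S_def intro!: divide_right_mono)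
      have same: "S * (parabola_map k i z $ 1 - v $ 1) < parabola_map k i z $ 2 - v $ 2"
        if "z \<in> Y i \<union> {0, parabola_end}" "z \<noteq> y" for z
        unfolding S_def 3(3) using parabola_map_slope[OF k s(3)[OF that]] .
      have y: "y \<noteq> 0" "y \<noteq> parabola_end" using Y[OF 3(1)] 3(2) by auto
      \<comment> \<open>The touching points at \<open>i / k\<close> and \<open>(i + 1) / k\<close>
        are the images of \<open>0\<close> and \<open>parabola_end\<close>, so they are covered by
        \<open>same\<close>.\<close>
      have left: "S * (real i / real k - v $ 1) < (real i)\<^sup>2 / (real k)\<^sup>2 - v $ 2"
        using same[of 0] y by (simp add: parabola_map_nth)
      have right: "S * (real (Suc i) / real k - v $ 1) < (real (Suc i))\<^sup>2 / (real k)\<^sup>2 - v $ 2"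
      proof -
        have "(real i)\<^sup>2 + 2 * real i * 1 + 1 = (real (Suc i))\<^sup>2" by (simp add: power2_eq_square algebra_simps)
        then show ?thesis
          using same[of parabola_end] y unfolding parabola_map_nth by (simp add: add.commute)
      qed
      have diff: "S * (parabola_map k j z $ 1 - v $ 1) < parabola_map k j z $ 2 - v $ 2"
        if z: "z \<in> ?T" and "j \<noteq> i" for j z
      proof (cases "j < i")
        case True
        have "parabola_map k j z $ 1 \<le> real i / real k"
          unfolding parabola_map_nth using True tangent_triangle_x(2)[OF z] by (intro divide_right_mono) auto
        then have "S * (parabola_map k j z $ 1 - real i / real k) \<le>
            2 * real i / real k * (parabola_map k j z $ 1 - real i / real k)"
          using S(1) by (intro mult_right_mono_neg) auto
        also have "\<dots> \<le> parabola_map k j z $ 2 - (real i)\<^sup>2 / (real k)\<^sup>2"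
          by (rule parabola_map_above_tangent[OF z k])
        finally show ?thesis
          using left by (simp add: algebra_simps)
      next
        case False
        then have "Suc i \<le> j" using \<open>j \<noteq> i\<close> by simp
        then have "real (Suc i) / real k \<le> parabola_map k j z $ 1"
          unfolding parabola_map_nth using tangent_triangle_x(1)[OF z] by (intro divide_right_mono) auto
        then have "S * (parabola_map k j z $ 1 - real (Suc i) / real k) \<le>
            2 * real (Suc i) / real k * (parabola_map k j z $ 1 - real (Suc i) / real k)"
          using S(2) by (intro mult_right_mono) auto
        also have "\<dots> \<le> parabola_map k j z $ 2 - (real (Suc i))\<^sup>2 / (real k)\<^sup>2"
          by (rule parabola_map_above_tangent[OF z k])
        finally show ?thesis
          using right by (simp add: algebra_simps)
      qed
      have "vector [- S, 1] \<bullet> v < vector [- S, 1] \<bullet> w" if w: "w \<in> ?U \<union> {0, parabola_end} - {v}" for w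
      proof -
        \<comment> \<open>The endpoints belong to the first and the last piece, so every
          \<open>w\<close> can be written as \<open>parabola_map k j z\<close>.\<close>
        have e0: "0 = parabola_map k 0 0"
          by (simp add: vec2_eq_iff parabola_map_nth)
        have e1: "parabola_end = parabola_map k (k - 1) parabola_end"
        proof -
          have "(real (k - 1))\<^sup>2 + 2 * real (k - 1) * 1 + 1 = (real k)\<^sup>2"
            using k by (simp add: power2_eq_square of_nat_diff algebra_simps)
          then show ?thesis
            using k by (simp add: vec2_eq_iff parabola_map_nth of_nat_diff)
        qed
        obtain j z where jz: "j < k" "z \<in> Y j \<union> {0, parabola_end}" "w = parabola_map k j z"
        proof -
          consider "w = 0" | "w = parabola_end" | j z where "j < k" "z \<in> Y j" "w = parabola_map k j z"
            using w by blast
          then show ?thesis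
          proof cases
            case 1
            then show ?thesis using that[of 0 0] e0 k by simp
          next
            case 2
            then show ?thesis using that[of "k - 1" parabola_end] e1 k by simp
          next
            case (3 j z)
            then show ?thesis using that by blast
          qed
        qed
        have "z \<in> ?T" using jz Y pT by blast
        have "S * (w $ 1 - v $ 1) < w $ 2 - v $ 2"
        proof (cases "j = i")
          case True
          then show ?thesis using jz same[of z] w 3(3) by auto
        next
          case False
          then show ?thesis using diff[OF \<open>z \<in> ?T\<close>] jz by simp
        qed
        then show ?thesis by (simp add: inner_vec2 algebra_simps)
      qed
      then show ?thesis by blast
    qed
  qed
  have "in_convex_position (?U \<union> {0, parabola_end})"
    unfolding in_convex_position_def
  proof
    fix v assume v: "v \<in> ?U \<union> {0, parabola_end}"
    show "v \<notin> convex hull (?U \<union> {0, parabola_end} - {v})"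
      using support[OF v] fin by (subst not_in_convex_hull_finite_iff) auto
  qed
  then show "convex_chain 0 tangent_apex parabola_end ?U"
    unfolding convex_chain_iff[OF ne] using fin UT out by blast
  have "card ?U = (\<Sum>i<k. card (parabola_map k i ` Y i))"
  proof (rule card_UN_disjoint)
    \<comment> \<open>By \<open>strict\<close>, different pieces occupy disjoint open vertical
      strips.\<close>
    have "parabola_map k i y \<noteq> parabola_map k j z" if "i < j" "j < k" "y \<in> Y i" "z \<in> Y j" for i j y z
    proof -
      have "real (Suc i) / real k \<le> real j / real k"
        using that by (intro divide_right_mono) auto
      then show ?thesis
        using strict(2)[of i y] strict(1)[of j z] that by auto
    qed
    then show "\<forall>i\<in>{..<k}. \<forall>j\<in>{..<k}. i \<noteq> j \<longrightarrow> parabola_map k i ` Y i \<inter> parabola_map k j ` Y j = {}"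
      by (auto simp: neq_iff) metis+
  qed (use Y in auto)
  also have "\<dots> = (\<Sum>i<k. card (Y i))"
    using inj_on_subset[OF inj_parabola_map[OF k]] by (intro sum.cong refl card_image) auto
  finally show "card ?U = (\<Sum>i<k. card (Y i))" .
qed

section \<open>Superadditivity of the longest chain and of its mean\<close>

lemma longest_chain_superadditive:
  assumes k: "k > 0" and fin: "finite X"
  shows "(\<Sum>i<k. longest_chain_length (parabola_map k i 0) (parabola_map k i tangent_apex)
      (parabola_map k i parabola_end) X) \<le> longest_chain_length 0 tangent_apex parabola_end X"
proof -
  have ne: "0 \<noteq> parabola_end" by (simp add: vec2_eq_iff)
  have "\<exists>Y. convex_chain 0 tangent_apex parabola_end Y \<and> parabola_map k i ` Y \<subseteq> X \<and>
     card Y = longest_chain_length (parabola_map k i 0) (parabola_map k i tangent_apex) (parabola_map k i parabola_end) X"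
    if "i < k" for i
  proof -
    note inj = inj_parabola_map[OF k, of i]
    note chain_iff = convex_chain_affine_image[OF linear_parabola_lin inj_parabola_lin[OF k, of i] ne,
        of "parabola_pt k i", folded parabola_map_def]
    have "parabola_map k i 0 \<noteq> parabola_map k i parabola_end" using inj ne by (simp add: inj_eq)
    then obtain Y where Y: "Y \<subseteq> X"
        "convex_chain (parabola_map k i 0) (parabola_map k i tangent_apex) (parabola_map k i parabola_end) Y"
        "card Y = longest_chain_length (parabola_map k i 0) (parabola_map k i tangent_apex) (parabola_map k i parabola_end) X"
      using longest_chain_attained[OF fin] by blast
    have "Y \<subseteq> parabola_map k i ` triangle 0 tangent_apex parabola_end"
      using Y(2) triangle_affine_image[OF linear_parabola_lin, of "parabola_pt k i" k i, folded parabola_map_def]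
      by (simp add: convex_chain_def)
    then obtain Y' where "Y = parabola_map k i ` Y'" by (meson subset_imageE)
    then show ?thesis
      using Y chain_iff card_image[OF inj_on_subset[OF inj, of Y']]
      by (intro exI[of _ Y']) auto
  qed
  then obtain Y where Y: "\<And>i. i < k \<Longrightarrow> convex_chain 0 tangent_apex parabola_end (Y i)"
    "\<And>i. i < k \<Longrightarrow> parabola_map k i ` Y i \<subseteq> X"
    "\<And>i. i < k \<Longrightarrow> card (Y i) = longest_chain_length (parabola_map k i 0) (parabola_map k i tangent_apex)
       (parabola_map k i parabola_end) X"
    by metis
  have "card (\<Union>i<k. parabola_map k i ` Y i) \<le> longest_chain_length 0 tangent_apex parabola_end X"
    using Y by (intro card_le_longest_chain[OF fin] parabola_map_chains_union(1)[OF k]) auto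
  then show ?thesis
    using Y by (simp add: parabola_map_chains_union(2)[OF k])
qed

text \<open>The inverse map \<open>?g\<close> enlarges the small triangle to the full one. It
  spreads \<open>M\<close> over a larger region, and the part inside the full triangle is
  \<open>M\<close> scaled by the area ratio, which is the situation of
  \<open>mean_chain_thinning\<close>.\<close>

lemma mean_chain_parabola_map:
  fixes M
  defines "M \<equiv> uniform_triangle 0 tangent_apex parabola_end"
  assumes i: "i < k"
  shows "mean_chain (parabola_map k i 0) (parabola_map k i tangent_apex) (parabola_map k i parabola_end) M n {} =
    (\<Sum>j\<le>n. ennreal (Bernstein n j (1 / real k ^ 3)) * mean_chain 0 tangent_apex parabola_end M j {})"
proof -
  let ?A = "parabola_map k i" and ?T = "triangle 0 tangent_apex parabola_end"
  have k: "k > 0" using i by simp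
  have ne: "0 \<noteq> parabola_end" by (simp add: vec2_eq_iff)
  note lin = linear_parabola_lin[of k i] and inj = inj_parabola_lin[OF k, of i]
  obtain B' where B': "linear B'" "\<And>x. B' (parabola_lin k i x) = x" "\<And>x. parabola_lin k i (B' x) = x"
    using linear_injective_isomorphism[OF lin inj] by blast
  let ?g = "\<lambda>y. B' (- parabola_pt k i) + B' y"
  have [measurable]: "?g \<in> borel_measurable borel" "?A \<in> borel_measurable borel"
    using borel_measurable_affine[OF B'(1)] borel_measurable_affine[OF lin, of "parabola_pt k i"]
    by (auto simp: parabola_map_def[abs_def])
  have gA: "?g (?A x) = x" and Ag: "?A (?g x) = x" for x
    using B' linear_add[OF B'(1)] linear_add[OF lin] linear_neg[OF B'(1)] linear_diff[OF lin]
    by (simp_all add: parabola_map_def)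
  have M: "prob_space M"
    unfolding M_def by (rule prob_space_uniform_triangle[OF noncollinear_tangent_triangle])
  have sM [measurable_cong]: "sets M = sets borel" by (simp add: M_def)
  have M': "prob_space (distr M borel ?g)"
    by (intro prob_space.prob_space_distr M) simp
  have "distr (distr M borel ?g) borel ?A = distr M borel (\<lambda>x. x)"
    by (subst distr_distr) (auto simp: o_def Ag)
  also have "\<dots> = M"
    by (rule distr_id2[OF sM[symmetric]])
  finally have MM': "distr (distr M borel ?g) borel ?A = M" .
  have thin: "emeasure (distr M borel ?g) (S \<inter> ?T) = ennreal (1 / real k ^ 3) * emeasure M S"
    if [measurable]: "S \<in> sets borel" for S
  proof -
    have "?g -` (S \<inter> ?T) = ?A ` (S \<inter> ?T)"
    proof (intro equalityI subsetI)
      fix x assume "x \<in> ?g -` (S \<inter> ?T)"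
      then have "?A (?g x) \<in> ?A ` (S \<inter> ?T)" by (intro imageI) simp
      then show "x \<in> ?A ` (S \<inter> ?T)" by (simp only: Ag)
    next
      fix x assume "x \<in> ?A ` (S \<inter> ?T)"
      then obtain y where "x = ?A y" "y \<in> S \<inter> ?T" by blast
      then show "x \<in> ?g -` (S \<inter> ?T)" by (simp only: vimage_eq gA)
    qed
    then have "emeasure (distr M borel ?g) (S \<inter> ?T) = emeasure M (?A ` (S \<inter> ?T))"
      by (simp add: emeasure_distr M_def)
    also have "\<dots> = emeasure lborel (?A ` (S \<inter> ?T)) / emeasure lborel ?T"
    proof -
      have "?A ` (S \<inter> ?T) \<in> sets borel"
        using emeasure_lborel_affine_image(1)[OF lin inj, of "S \<inter> ?T" "parabola_pt k i", folded parabola_map_def]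
          bounded_triangle by (simp add: bounded_Int)
      moreover have "?T \<inter> ?A ` (S \<inter> ?T) = ?A ` (S \<inter> ?T)"
        using parabola_map_triangle_subset[OF i] by blast
      ultimately show ?thesis by (simp add: M_def)
    qed
    also have "emeasure lborel (?A ` (S \<inter> ?T)) = ennreal (1 / real k ^ 3) * emeasure lborel (S \<inter> ?T)"
      using emeasure_lborel_affine_image(2)[OF lin inj, of "S \<inter> ?T" "parabola_pt k i", folded parabola_map_def]
        bounded_triangle[of 0 tangent_apex parabola_end] det_parabola_lin[OF k, of i] by (simp add: bounded_Int)
    finally show ?thesis
      by (simp add: M_def ennreal_times_divide Int_commute)
  qed
  have p: "0 \<le> 1 / real k ^ 3" "1 / real k ^ 3 \<le> 1"
    using k by (auto simp: divide_le_eq_1)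
  have "mean_chain (?A 0) (?A tangent_apex) (?A parabola_end) M n {} =
      mean_chain 0 tangent_apex parabola_end (distr M borel ?g) n {}"
    using mean_chain_affine[OF lin inj ne M', of "{}" "parabola_pt k i" tangent_apex n, folded parabola_map_def] MM'
    by simp
  also have "\<dots> = (\<Sum>j\<le>n. ennreal (Bernstein n j (1 / real k ^ 3)) * mean_chain 0 tangent_apex parabola_end M j {})"
    by (rule mean_chain_thinning[OF ne M sM M' _ p thin]) auto
  finally show ?thesis .
qed

lemma mean_longest_chain_nonneg: "0 \<le> mean_longest_chain n"
  by (simp add: mean_longest_chain_def)

lemma mean_longest_chain_mono: "m \<le> n \<Longrightarrow> mean_longest_chain m \<le> mean_longest_chain n"
proof -
  assume "m \<le> n"
  have ne: "vector [0, 1] \<noteq> (0 :: real^2)" by (simp add: vec2_eq_iff)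
  have "ennreal (mean_longest_chain m) \<le> ennreal (mean_longest_chain n)"
    unfolding mean_chain_triangle[OF noncollinear_unit_triangle, symmetric]
    by (intro mean_chain_mono_index[OF ne prob_space_uniform_triangle[OF noncollinear_unit_triangle]])
       (use \<open>m \<le> n\<close> in auto)
  then show ?thesis
    by (simp add: ennreal_le_iff mean_longest_chain_nonneg)
qed

text \<open>Expectations are taken in \<open>longest_chain_superadditive\<close>; the
  \<open>k\<close> summands have the same mean, a binomial mixture of the values of
  \<open>mean_longest_chain\<close>.\<close>

lemma mean_longest_chain_superadditive:
  assumes k: "k > 0"
  shows "real k * (\<Sum>j\<le>n. Bernstein n j (1 / real k ^ 3) * mean_longest_chain j) \<le> mean_longest_chain n"
proof -
  let ?M = "uniform_triangle 0 tangent_apex parabola_end"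
  let ?L = "\<lambda>i X. longest_chain_length (parabola_map k i 0) (parabola_map k i tangent_apex) (parabola_map k i parabola_end) X"
  have ne: "0 \<noteq> parabola_end" by (simp add: vec2_eq_iff)
  have nei: "parabola_map k i 0 \<noteq> parabola_map k i parabola_end" for i
    using ne inj_parabola_map[OF k] by (simp add: inj_eq)
  have M: "prob_space ?M" by (rule prob_space_uniform_triangle[OF noncollinear_tangent_triangle])
  have p: "0 \<le> 1 / real k ^ 3" "1 / real k ^ 3 \<le> 1"
    using k by (auto simp: divide_le_eq_1)
  have meas: "(\<lambda>x. of_nat (?L i (x ` {..<n})) :: ennreal) \<in> borel_measurable (\<Pi>\<^sub>M i\<in>{..<n}. ?M)" for i
  proof -
    have "(\<lambda>x. ?L i ({} \<union> (\<lambda>i. x i) ` {..<n})) \<in> (\<Pi>\<^sub>M i\<in>{..<n}. ?M) \<rightarrow>\<^sub>M count_space UNIV"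
      by (rule measurable_longest_chain[OF nei]) auto
    then show ?thesis by simp
  qed
  have "ennreal (\<Sum>j\<le>n. Bernstein n j (1 / real k ^ 3) * mean_longest_chain j) =
    (\<Sum>j\<le>n. ennreal (Bernstein n j (1 / real k ^ 3)) * mean_chain 0 tangent_apex parabola_end ?M j {})"
  proof -
    have "ennreal (\<Sum>j\<le>n. Bernstein n j (1 / real k ^ 3) * mean_longest_chain j) =
      (\<Sum>j\<le>n. ennreal (Bernstein n j (1 / real k ^ 3) * mean_longest_chain j))"
      by (rule sum_ennreal[symmetric]) (intro mult_nonneg_nonneg Bernstein_nonneg p mean_longest_chain_nonneg)
    then show ?thesis
      using p by (simp only: mean_chain_triangle[OF noncollinear_tangent_triangle] ennreal_mult
          Bernstein_nonneg mean_longest_chain_nonneg)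
  qed
  then have "ennreal (real k * (\<Sum>j\<le>n. Bernstein n j (1 / real k ^ 3) * mean_longest_chain j)) =
    (\<Sum>i<k. \<Sum>j\<le>n. ennreal (Bernstein n j (1 / real k ^ 3)) * mean_chain 0 tangent_apex parabola_end ?M j {})"
    by (simp add: ennreal_mult' ennreal_of_nat_eq_real_of_nat)
  also have "\<dots> = (\<Sum>i<k. mean_chain (parabola_map k i 0) (parabola_map k i tangent_apex) (parabola_map k i parabola_end) ?M n {})"
    by (simp add: mean_chain_parabola_map)
  also have "\<dots> = (\<Sum>i<k. \<integral>\<^sup>+x. of_nat (?L i (x ` {..<n})) \<partial>(\<Pi>\<^sub>M i\<in>{..<n}. ?M))"
    by (simp add: mean_chain_eq_PiM[OF nei M])
  also have "\<dots> = (\<integral>\<^sup>+x. of_nat (\<Sum>i<k. ?L i (x ` {..<n})) \<partial>(\<Pi>\<^sub>M i\<in>{..<n}. ?M))"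
    using meas by (simp add: nn_integral_sum)
  also have "\<dots> \<le> (\<integral>\<^sup>+x. of_nat (longest_chain_length 0 tangent_apex parabola_end (x ` {..<n})) \<partial>(\<Pi>\<^sub>M i\<in>{..<n}. ?M))"
    by (intro nn_integral_mono, subst of_nat_le_iff) (intro longest_chain_superadditive[OF k], simp)
  also have "\<dots> = ennreal (mean_longest_chain n)"
    unfolding mean_chain_triangle[OF noncollinear_tangent_triangle, symmetric] mean_chain_eq_PiM[OF ne M sets_uniform_measure[THEN trans[OF _ sets_lborel]] finite.emptyI]
    by simp
  finally show ?thesis
    by (simp add: ennreal_le_iff mean_longest_chain_nonneg)
qed

section \<open>Binomial concentration\<close>

lemma Bernstein_variance:
  "(\<Sum>j\<le>n. (real j - real n * p)\<^sup>2 * Bernstein n j p) = real n * p * (1 - p)"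
proof -
  \<comment> \<open>The square is expanded in the factorial moments \<open>j (j - 1)\<close>,
    \<open>j\<close> and 1, whose sums are known.\<close>
  have "(real j - real n * p)\<^sup>2 * Bernstein n j p = real j * (real j - 1) * Bernstein n j p +
     (1 - 2 * real n * p) * (real j * Bernstein n j p) + (real n * p)\<^sup>2 * Bernstein n j p" for j
    by (simp add: power2_eq_square algebra_simps)
  then have "(\<Sum>j\<le>n. (real j - real n * p)\<^sup>2 * Bernstein n j p) =
     (\<Sum>j\<le>n. real j * (real j - 1) * Bernstein n j p) +
     (1 - 2 * real n * p) * (\<Sum>j\<le>n. real j * Bernstein n j p) + (real n * p)\<^sup>2 * (\<Sum>j\<le>n. Bernstein n j p)"
    by (simp only: sum.distrib sum_distrib_left)
  also have "\<dots> = real n * (real n - 1) * p\<^sup>2 + (1 - 2 * real n * p) * (real n * p) + (real n * p)\<^sup>2"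
    by (simp only: sum_kk_Bernstein sum_k_Bernstein sum_Bernstein mult_1_right)
  also have "\<dots> = real n * p * (1 - p)"
    by (simp add: power2_eq_square algebra_simps)
  finally show ?thesis .
qed

text \<open>Chebyshev's inequality for the lower tail, with the variance bounded by
  \<open>n p\<close>.\<close>

lemma Bernstein_tail:
  assumes p: "0 \<le> p" "p \<le> 1" and m: "real m < real n * p"
  shows "1 - real n * p / (real n * p - real m)\<^sup>2 \<le> (\<Sum>j\<in>{m..n}. Bernstein n j p)"
proof -
  have mn: "m \<le> n"
  proof -
    have "real n * p \<le> real n" using p by (simp add: mult_left_le)
    then show ?thesis using m by linarith
  qed
  have "(real n * p - real m)\<^sup>2 * (\<Sum>j<m. Bernstein n j p) \<le> (\<Sum>j<m. (real j - real n * p)\<^sup>2 * Bernstein n j p)"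
    unfolding sum_distrib_left
  proof (intro sum_mono mult_right_mono)
    fix j assume "j \<in> {..<m}"
    then have "real n * p - real m \<le> real n * p - real j" by simp
    then have "(real n * p - real m)\<^sup>2 \<le> (real n * p - real j)\<^sup>2"
      using m by (intro power_mono) auto
    then show "(real n * p - real m)\<^sup>2 \<le> (real j - real n * p)\<^sup>2"
      by (simp add: power2_commute)
  qed (use p in \<open>simp add: Bernstein_nonneg\<close>)
  also have "\<dots> \<le> (\<Sum>j\<le>n. (real j - real n * p)\<^sup>2 * Bernstein n j p)"
    using mn p by (intro sum_mono2) (auto simp: Bernstein_nonneg)
  also have "\<dots> \<le> real n * p"
    unfolding Bernstein_variance using p by (simp add: mult_left_le)
  finally have "(\<Sum>j<m. Bernstein n j p) \<le> real n * p / (real n * p - real m)\<^sup>2"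
    using m by (simp add: le_divide_eq mult.commute)
  moreover have "(\<Sum>j\<le>n. Bernstein n j p) = (\<Sum>j<m. Bernstein n j p) + (\<Sum>j\<in>{m..n}. Bernstein n j p)"
  proof -
    have "{..n} = {..<m} \<union> {m..n}" using mn by auto
    then show ?thesis by (simp only:) (rule sum.union_disjoint, auto)
  qed
  ultimately show ?thesis by simp
qed

text \<open>Counts below \<open>m\<close> are discarded, and monotonicity replaces every larger
  count by \<open>m\<close>; what remains is the Chebyshev weight.\<close>

lemma mean_longest_chain_lower:
  assumes k: "k > 0" and m: "real m < real n / real k ^ 3"
  shows "real k * (1 - (real n / real k ^ 3) / (real n / real k ^ 3 - real m)\<^sup>2) * mean_longest_chain m \<le> mean_longest_chain n"
proof -
  let ?p = "1 / real k ^ 3"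
  have p: "0 \<le> ?p" "?p \<le> 1"
    using k by (auto simp: divide_le_eq_1)
  have "(1 - (real n * ?p) / (real n * ?p - real m)\<^sup>2) * mean_longest_chain m \<le>
      (\<Sum>j\<in>{m..n}. Bernstein n j ?p) * mean_longest_chain m"
    using m p by (intro mult_right_mono Bernstein_tail mean_longest_chain_nonneg) auto
  also have "\<dots> \<le> (\<Sum>j\<in>{m..n}. Bernstein n j ?p * mean_longest_chain j)"
    unfolding sum_distrib_right using p
    by (intro sum_mono mult_left_mono Bernstein_nonneg mean_longest_chain_mono) auto
  also have "\<dots> \<le> (\<Sum>j\<le>n. Bernstein n j ?p * mean_longest_chain j)"
    using p by (intro sum_mono2) (auto simp: Bernstein_nonneg mean_longest_chain_nonneg)
  finally have "real k * ((1 - (real n * ?p) / (real n * ?p - real m)\<^sup>2) * mean_longest_chain m) \<le>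
     real k * (\<Sum>j\<le>n. Bernstein n j ?p * mean_longest_chain j)"
    by (intro mult_left_mono) auto
  also have "\<dots> \<le> mean_longest_chain n"
    by (rule mean_longest_chain_superadditive[OF k])
  finally show ?thesis by (simp add: mult.assoc)
qed

text \<open>Each point of a box of positive probability is a chain by itself. Positivity of the
  limit rests on this.\<close>

lemma mean_longest_chain_one_pos: "0 < mean_longest_chain 1"
proof -
  let ?p0 = "vector [0, 1] :: real^2" and ?p1 = "vector [1, 0] :: real^2"
  have ne: "?p0 \<noteq> 0" by (simp add: vec2_eq_iff)
  have one: "1 \<le> longest_chain_length ?p0 ?p1 0 {y}" if y: "y \<in> box 0 (vector [1/2, 1/2])" for y
  proof -
    have y: "0 < y $ 1" "0 < y $ 2" "y $ 1 < 1/2" "y $ 2 < 1/2"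
      using y by (auto simp: mem_box_cart forall_2)
    have n: "y \<noteq> ?p0" "y \<noteq> 0" using y by (auto simp: vec2_eq_iff)
    have "y \<notin> convex hull {?p0, 0}"
      using y by (subst not_in_convex_hull_finite_iff) (auto simp: inner_vec2 intro!: exI[of _ "vector [-1, 0]"])
    moreover have "?p0 \<notin> convex hull {y, 0}"
      using y by (subst not_in_convex_hull_finite_iff) (auto simp: inner_vec2 intro!: exI[of _ "vector [0, -1]"])
    moreover have "0 \<notin> convex hull {y, ?p0}"
      using y by (subst not_in_convex_hull_finite_iff) (auto simp: inner_vec2 intro!: exI[of _ "vector [1, 1]"])
    ultimately have "in_convex_position ({y} \<union> {?p0, 0})"
      using n ne by (simp add: in_convex_position_def insert_Diff_if insert_commute)
    then have "convex_chain ?p0 ?p1 0 {y}"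
      using y n by (simp add: convex_chain_iff[OF ne] mem_unit_triangle)
    then show ?thesis
      using card_le_longest_chain[of "{y}" "{y}" ?p0 ?p1 0] by simp
  qed
  let ?M = "uniform_triangle ?p0 ?p1 0" and ?B = "box 0 (vector [1/2, 1/2]) :: (real^2) set"
  have "0 < emeasure lborel ?B"
    by (simp add: emeasure_half_box)
  then have "0 < emeasure ?M ?B"
    using half_box_subset emeasure_triangle_pos[OF noncollinear_unit_triangle]
    by (simp add: Int_absorb1 ennreal_zero_less_divide)
  also have "emeasure ?M ?B = (\<integral>\<^sup>+y. indicator ?B y \<partial>?M)"
    by simp
  also have "\<dots> \<le> (\<integral>\<^sup>+y. of_nat (longest_chain_length ?p0 ?p1 0 {y}) \<partial>?M)"
  proof (intro nn_integral_mono)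
    fix y show "indicator ?B y \<le> (of_nat (longest_chain_length ?p0 ?p1 0 {y}) :: ennreal)"
      using one[of y] of_nat_mono[of 1 "longest_chain_length ?p0 ?p1 0 {y}", where 'a=ennreal]
      by (auto simp: indicator_def)
  qed
  also have "\<dots> = ennreal (mean_longest_chain 1)"
    unfolding mean_chain_triangle[OF noncollinear_unit_triangle, symmetric] by simp
  finally show ?thesis by simp
qed

section \<open>The upper bound\<close>

text \<open>Chains in the triangle with vertices \<open>(a, b)\<close>, \<open>(u, 0)\<close>, \<open>(0, 0)\<close>, listed from \<open>(a, b)\<close> on. The line
  from \<open>(a, b)\<close> through \<open>z\<close> meets the axis in \<open>(foot a b z, 0)\<close>, and the rest of a chain that starts
  with \<open>z\<close> is a chain of the triangle with vertices \<open>z\<close>, \<open>(foot a b z, 0)\<close>, \<open>(0, 0)\<close>.\<close>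

definition foot :: "real \<Rightarrow> real \<Rightarrow> real^2 \<Rightarrow> real" where
  "foot a b z = (b * z $ 1 - a * z $ 2) / (b - z $ 2)"

fun ordered_chain :: "real \<Rightarrow> real \<Rightarrow> real \<Rightarrow> (real^2) list \<Rightarrow> bool" where
  "ordered_chain a b u [] \<longleftrightarrow> True"
| "ordered_chain a b u (z # zs) \<longleftrightarrow> 0 \<le> z $ 2 \<and> z $ 2 < b \<and> 0 \<le> foot a b z \<and> foot a b z \<le> u \<and>
     ordered_chain (z $ 1) (z $ 2) (foot a b z) zs"

text \<open>Here \<open>z\<close> is the next vertex of the chain. If another point \<open>y\<close>
  with a smaller foot were not below the segment from \<open>z\<close> to the origin extended to the
  line through \<open>(a, b)\<close>, it would fall into the triangle with vertices
  \<open>(a, b)\<close>, \<open>z\<close>, \<open>0\<close>; the conclusions place it in the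
  triangle that remains after peeling.\<close>

lemma foot_after_peeling:
  fixes y z :: "real^2"
  assumes y: "0 \<le> y $ 2" "y $ 2 < b" "0 \<le> foot a b y" and z: "0 \<le> z $ 2" "z $ 2 < b"
    and le: "foot a b y \<le> foot a b z"
    and yz: "y \<notin> convex hull {vector [a, b], z, 0}" and z0: "z \<notin> convex hull {vector [a, b], 0}"
  shows "y $ 2 < z $ 2" "0 \<le> foot (z $ 1) (z $ 2) y" "foot (z $ 1) (z $ 2) y \<le> foot a b z"
proof -
  \<comment> \<open>\<open>y\<close> is the convex combination of \<open>(a, b)\<close> and
    \<open>(v, 0)\<close> with weight \<open>\<alpha>\<close> on \<open>(a, b)\<close>; likewise
    \<open>z\<close> with \<open>(w, 0)\<close> and weight \<open>\<gamma>\<close>.\<close>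
  define w v \<alpha> \<gamma> where "w = foot a b z" and "v = foot a b y" and "\<alpha> = y $ 2 / b" and "\<gamma> = z $ 2 / b"
  have b: "b > 0" using y by linarith
  have \<alpha>: "0 \<le> \<alpha>" "\<alpha> < 1" and \<gamma>: "0 \<le> \<gamma>" "\<gamma> < 1"
    using y z b by (auto simp: \<alpha>_def \<gamma>_def)
  have y2: "y $ 2 = \<alpha> * b" and z2: "z $ 2 = \<gamma> * b"
    using b by (auto simp: \<alpha>_def \<gamma>_def)
  have y1: "y $ 1 = \<alpha> * a + (1 - \<alpha>) * v"
    using y b by (simp add: \<alpha>_def v_def foot_def field_simps)
  have z1: "z $ 1 = \<gamma> * a + (1 - \<gamma>) * w"
    using z b by (simp add: \<gamma>_def w_def foot_def field_simps)
  have v: "0 \<le> v" "v \<le> w" using y le by (auto simp: v_def w_def)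
  have "w \<noteq> 0"
  proof
    assume "w = 0"
    then have "z = \<gamma> *\<^sub>R vector [a, b] + (1 - \<gamma>) *\<^sub>R 0"
      using z1 z2 by (simp add: vec2_eq_iff)
    then have "z \<in> convex hull {vector [a, b], 0}"
      unfolding convex_hull_2
      by (intro CollectI exI[of _ \<gamma>] exI[of _ "1 - \<gamma>"] conjI) (use \<gamma> in auto)
    then show False using z0 by blast
  qed
  then have w: "w > 0" using v by linarith
  \<comment> \<open>\<open>t\<close> is the coefficient of \<open>z\<close> when \<open>y\<close> is
    expanded in \<open>(a, b)\<close>, \<open>z\<close> and \<open>0\<close>; it is found by
    comparing the contributions of the feet.\<close>
  define t where "t = (1 - \<alpha>) * (v / w) / (1 - \<gamma>)"
  have t: "t \<ge> 0" using \<alpha> \<gamma> v w by (simp add: t_def)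
  have tg: "t * (1 - \<gamma>) * w = (1 - \<alpha>) * v"
    using \<gamma> w by (simp add: t_def)
  have tle: "t * (1 - \<gamma>) \<le> 1 - \<alpha>"
  proof -
    have "t * (1 - \<gamma>) = (1 - \<alpha>) * (v / w)"
      using \<gamma> by (simp add: t_def)
    also have "\<dots> \<le> (1 - \<alpha>) * 1"
      using \<alpha> v w by (intro mult_left_mono) auto
    finally show ?thesis by simp
  qed
  \<comment> \<open>The coefficient of \<open>(a, b)\<close> is
    \<open>\<alpha> - \<gamma> * t\<close>. The other two are nonnegative, so it must be negative
    for \<open>y\<close> to avoid the hull.\<close>
  have key: "\<alpha> < \<gamma> * t"
  proof (rule ccontr)
    assume "\<not> \<alpha> < \<gamma> * t"
    then have c: "\<alpha> - \<gamma> * t \<ge> 0" by simp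
    have s: "1 - t - (\<alpha> - \<gamma> * t) \<ge> 0" using tle by (simp add: algebra_simps)
    have "y $ 1 = (\<alpha> - \<gamma> * t) * a + t * z $ 1"
      unfolding y1 z1 using tg by (simp add: algebra_simps)
    moreover have "y $ 2 = (\<alpha> - \<gamma> * t) * b + t * z $ 2"
      unfolding y2 z2 by (simp add: algebra_simps)
    ultimately have "y = (\<alpha> - \<gamma> * t) *\<^sub>R vector [a, b] + t *\<^sub>R z + (1 - t - (\<alpha> - \<gamma> * t)) *\<^sub>R 0"
      by (simp add: vec2_eq_iff)
    moreover have "(\<alpha> - \<gamma> * t) + t + (1 - t - (\<alpha> - \<gamma> * t)) = 1" by simp
    ultimately have "y \<in> convex hull {vector [a, b], z, 0}"
      unfolding convex_hull_3 using c s t by blast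
    then show False using yz by blast
  qed
  have "\<gamma> * t * (1 - \<gamma>) \<le> \<gamma> * (1 - \<alpha>)"
    using mult_left_mono[OF tle \<gamma>(1)] by (simp add: mult.assoc)
  moreover have "\<alpha> * (1 - \<gamma>) < \<gamma> * t * (1 - \<gamma>)"
    using key \<gamma> by simp
  ultimately have \<alpha>\<gamma>: "\<alpha> < \<gamma>" by (simp add: algebra_simps)
  then show lt: "y $ 2 < z $ 2" using b by (simp add: y2 z2)
  have num: "z $ 2 * y $ 1 - z $ 1 * y $ 2 = b * (\<gamma> * ((1 - \<alpha>) * v) - (1 - \<gamma>) * \<alpha> * w)"
    unfolding y1 y2 z1 z2 by (simp add: algebra_simps)
  have "(1 - \<gamma>) * \<alpha> * w \<le> (1 - \<gamma>) * (\<gamma> * t) * w"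
    using key \<gamma> w by (intro mult_right_mono mult_left_mono) auto
  also have "\<dots> = \<gamma> * ((1 - \<alpha>) * v)"
    unfolding tg[symmetric] by (simp add: mult_ac)
  finally have "0 \<le> z $ 2 * y $ 1 - z $ 1 * y $ 2"
    unfolding num using b by simp
  then show "0 \<le> foot (z $ 1) (z $ 2) y"
    using lt by (simp add: foot_def)
  have "\<gamma> * ((1 - \<alpha>) * v) \<le> \<gamma> * ((1 - \<alpha>) * w)"
    using \<alpha> \<gamma> v by (intro mult_left_mono) auto
  then have "\<gamma> * ((1 - \<alpha>) * v) - (1 - \<gamma>) * \<alpha> * w \<le> w * (\<gamma> - \<alpha>)"
    by (simp add: algebra_simps)
  then have "b * (\<gamma> * ((1 - \<alpha>) * v) - (1 - \<gamma>) * \<alpha> * w) \<le> b * (w * (\<gamma> - \<alpha>))"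
    using b by (intro mult_left_mono) auto
  then have "z $ 2 * y $ 1 - z $ 1 * y $ 2 \<le> w * (z $ 2 - y $ 2)"
    unfolding num by (simp add: y2 z2 algebra_simps)
  then show "foot (z $ 1) (z $ 2) y \<le> foot a b z"
    unfolding w_def[symmetric] using lt by (simp add: foot_def divide_le_eq)
qed

text \<open>The vertex following \<open>(a, b)\<close> is the point with the largest foot. Removing
  it gives the same situation with apex \<open>z\<close> and base length \<open>foot a b z\<close>,
  hence the induction over arbitrary \<open>a\<close>, \<open>b\<close>, \<open>u\<close>.\<close>

lemma ordered_chain_exists:
  fixes Y :: "(real^2) set"
  assumes "finite Y"
    and "\<And>y. y \<in> Y \<Longrightarrow> 0 \<le> y $ 2 \<and> y $ 2 < b \<and> 0 \<le> foot a b y \<and> foot a b y \<le> u"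
    and "\<And>y. y \<in> Y \<Longrightarrow> y \<notin> convex hull (insert (vector [a, b]) (insert 0 (Y - {y})))"
  shows "\<exists>zs. distinct zs \<and> set zs = Y \<and> ordered_chain a b u zs"
  using assms
proof (induction "card Y" arbitrary: Y a b u)
  case 0
  then show ?case by (intro exI[of _ "[]"]) auto
next
  case (Suc n)
  have "Y \<noteq> {}" using Suc.hyps by auto
  then have "Max (foot a b ` Y) \<in> foot a b ` Y"
    using Suc.prems(1) by (intro Max_in) auto
  then obtain z where z': "z \<in> Y" "Max (foot a b ` Y) = foot a b z" by blast
  have z: "z \<in> Y" "\<And>y. y \<in> Y \<Longrightarrow> foot a b y \<le> foot a b z"
    unfolding z'(2)[symmetric] using Suc.prems(1) z'(1) by auto
  let ?w = "foot a b z"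
  note zD = Suc.prems(2)[OF z(1)]
  have z0: "z \<notin> convex hull {vector [a, b], 0}"
    using Suc.prems(3)[OF z(1)] hull_mono[of "{vector [a, b], 0}" "insert (vector [a, b]) (insert 0 (Y - {z}))" convex]
    by auto
  have "\<exists>zs. distinct zs \<and> set zs = Y - {z} \<and> ordered_chain (z $ 1) (z $ 2) ?w zs"
  proof (rule Suc.hyps(1))
    show "n = card (Y - {z})" "finite (Y - {z})"
      using Suc.hyps(2) Suc.prems(1) z(1) by auto
  next
    fix y assume y: "y \<in> Y - {z}"
    then have yY: "y \<in> Y" by simp
    have yz: "y \<notin> convex hull {vector [a, b], z, 0}"
      using Suc.prems(3)[OF yY] y z(1)
        hull_mono[of "{vector [a, b], z, 0}" "insert (vector [a, b]) (insert 0 (Y - {y}))" convex] by auto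
    show "0 \<le> y $ 2 \<and> y $ 2 < z $ 2 \<and> 0 \<le> foot (z $ 1) (z $ 2) y \<and> foot (z $ 1) (z $ 2) y \<le> ?w"
      using foot_after_peeling[of y b a z, OF _ _ _ _ _ z(2)[OF yY] yz z0] Suc.prems(2)[OF yY] zD by blast
    have "vector [z $ 1, z $ 2] = z" by (simp add: vec2_eq_iff)
    \<comment> \<open>The new apex \<open>z\<close> is already one of the points of
      \<open>Y - {y}\<close>, so the new hull is contained in the old one.\<close>
    then show "y \<notin> convex hull (insert (vector [z $ 1, z $ 2]) (insert 0 (Y - {z} - {y})))"
      using Suc.prems(3)[OF yY] y z(1)
        hull_mono[of "insert z (insert 0 (Y - {z} - {y}))" "insert (vector [a, b]) (insert 0 (Y - {y}))" convex] by auto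
  qed
  then obtain zs where "distinct zs" "set zs = Y - {z}" "ordered_chain (z $ 1) (z $ 2) ?w zs" by blast
  then show ?case
    using z(1) zD by (intro exI[of _ "z # zs"]) auto
qed

lemma borel_measurable_vec_nth_real [measurable (raw)]:
  fixes f :: "'b \<Rightarrow> real^'n"
  assumes "f \<in> borel_measurable N"
  shows "(\<lambda>x. f x $ i) \<in> borel_measurable N"
  using assms by (rule measurable_compose) (intro borel_measurable_continuous_onI continuous_intros)

text \<open>\<open>a\<close>, \<open>b\<close> and \<open>u\<close> are random because the recursion
  replaces them by data of the preceding point.\<close>

lemma measurable_ordered_chain:
  fixes g :: "'i \<Rightarrow> 'b \<Rightarrow> real^2"
  assumes [measurable]: "a \<in> borel_measurable N" "b \<in> borel_measurable N" "u \<in> borel_measurable N"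
    and "\<And>i. i \<in> set xs \<Longrightarrow> g i \<in> borel_measurable N"
  shows "Measurable.pred N (\<lambda>\<omega>. ordered_chain (a \<omega>) (b \<omega>) (u \<omega>) (map (\<lambda>i. g i \<omega>) xs))"
  using assms
proof (induction xs arbitrary: a b u)
  case (Cons i xs)
  note [measurable] = Cons.prems(1-3)
  have [measurable]: "g i \<in> borel_measurable N" using Cons.prems(4) by simp
  have [measurable]: "(\<lambda>\<omega>. foot (a \<omega>) (b \<omega>) (g i \<omega>)) \<in> borel_measurable N"
    unfolding foot_def by measurable
  have [measurable]: "Measurable.pred N (\<lambda>\<omega>. ordered_chain (g i \<omega> $ 1) (g i \<omega> $ 2) (foot (a \<omega>) (b \<omega>) (g i \<omega>))
      (map (\<lambda>i. g i \<omega>) xs))"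
    by (rule Cons.IH) (use Cons.prems(4) in auto)
  show ?case
    by simp
qed simp

section \<open>Plane integrals over the position of the first chain point\<close>

lemma lborel_vec2: "(lborel :: (real^2) measure) = distr (lborel \<Otimes>\<^sub>M lborel) borel (\<lambda>(s, t). vector [s, t])"
proof (rule lborel_eqI)
  have vec: "vector [s, t] = s *\<^sub>R axis 1 1 + t *\<^sub>R (axis 2 1 :: real^2)" for s t
    by (simp add: vec2_eq_iff axis_def)
  have [measurable]: "(\<lambda>(s, t). vector [s, t] :: real^2) \<in> borel_measurable (lborel \<Otimes>\<^sub>M lborel)"
    unfolding vec by measurable
  fix l u :: "real^2"
  assume le: "\<And>b. b \<in> Basis \<Longrightarrow> l \<bullet> b \<le> u \<bullet> b"
  have le': "l $ i \<le> u $ i" for i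
    using le[of "axis i 1"] by (simp add: inner_axis axis_in_Basis_iff)
  have "emeasure (distr (lborel \<Otimes>\<^sub>M lborel) borel (\<lambda>(s, t). vector [s, t])) (box l u) =
      emeasure (lborel \<Otimes>\<^sub>M lborel) ({l $ 1<..<u $ 1} \<times> {l $ 2<..<u $ 2})"
    by (subst emeasure_distr) (auto intro!: arg_cong2[where f=emeasure] simp: mem_box_cart forall_2 space_pair_measure)
  also have "\<dots> = ennreal (u $ 1 - l $ 1) * ennreal (u $ 2 - l $ 2)"
    by (subst lborel.emeasure_pair_measure_Times) (auto simp: le')
  also have "\<dots> = ennreal (\<Prod>b\<in>Basis. (u - l) \<bullet> b)"
  proof -
    have "(\<Prod>b\<in>Basis. (u - l) \<bullet> b) = (u $ 1 - l $ 1) * (u $ 2 - l $ 2)"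
      unfolding Basis_vec2(1) using Basis_vec2(2) by (simp add: inner_axis)
    then show ?thesis
      using le'[of 1] le'[of 2] by (simp add: ennreal_mult)
  qed
  finally show "emeasure (distr (lborel \<Otimes>\<^sub>M lborel) borel (\<lambda>(s, t). vector [s, t])) (box l u) =
     ennreal (\<Prod>b\<in>Basis. (u - l) \<bullet> b)" .
qed simp

lemma nn_integral_vec2:
  fixes h :: "real^2 \<Rightarrow> ennreal"
  assumes [measurable]: "h \<in> borel_measurable borel"
  shows "(\<integral>\<^sup>+y. h y \<partial>lborel) = (\<integral>\<^sup>+t. \<integral>\<^sup>+s. h (vector [s, t]) \<partial>lborel \<partial>lborel)"
proof -
  have vec: "vector [s, t] = s *\<^sub>R axis 1 1 + t *\<^sub>R (axis 2 1 :: real^2)" for s t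
    by (simp add: vec2_eq_iff axis_def)
  have [measurable]: "(\<lambda>(s, t). vector [s, t] :: real^2) \<in> borel_measurable (lborel \<Otimes>\<^sub>M lborel)"
    unfolding vec by measurable
  have "(\<integral>\<^sup>+y. h y \<partial>lborel) = (\<integral>\<^sup>+p. h (case p of (s, t) \<Rightarrow> vector [s, t]) \<partial>(lborel \<Otimes>\<^sub>M lborel))"
    by (subst lborel_vec2, subst nn_integral_distr) auto
  also have "\<dots> = (\<integral>\<^sup>+t. \<integral>\<^sup>+s. h (vector [s, t]) \<partial>lborel \<partial>lborel)"
    by (subst lborel_pair.nn_integral_snd[symmetric]) auto
  finally show ?thesis .
qed

lemma nn_integral_power_Icc:
  assumes "0 \<le> (c::real)"
  shows "(\<integral>\<^sup>+x. ennreal (x ^ k) * indicator {0..c} x \<partial>lborel) = ennreal (c ^ Suc k / Suc k)"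
proof -
  have "(\<integral>\<^sup>+x. ennreal (x ^ k) * indicator {0..c} x \<partial>lborel) = ennreal (c ^ Suc k / Suc k - 0 ^ Suc k / Suc k)"
    using assms
    by (intro nn_integral_FTC_Icc) (auto intro!: derivative_eq_intros simp del: power_Suc of_nat_Suc)
  then show ?thesis by simp
qed

text \<open>The weight \<open>(b - h) / b\<close> is the relative width of the triangle at height
  \<open>h\<close>. The exact factor \<open>1 / ((k + 1) (k + 2))\<close> is relaxed to
  \<open>1 / (k + 1)^2\<close> so that the final product is a cube of factorials.\<close>

lemma nn_integral_power_hat_Icc:
  assumes "0 < (b::real)"
  shows "(\<integral>\<^sup>+h. ennreal ((b - h) / b * h ^ k) * indicator {0..b} h \<partial>lborel) \<le> ennreal (b ^ Suc k / (real (Suc k))\<^sup>2)"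
proof -
  let ?F = "\<lambda>h. h ^ Suc k / Suc k - h ^ Suc (Suc k) / Suc (Suc k) / b"
  have d: "((\<lambda>x. x ^ Suc m / Suc m) has_field_derivative x ^ m) (at x)" for m and x :: real
    by (auto intro!: derivative_eq_intros simp del: power_Suc of_nat_Suc)
  have "(\<integral>\<^sup>+h. ennreal ((b - h) / b * h ^ k) * indicator {0..b} h \<partial>lborel) = ennreal (?F b - ?F 0)"
  proof (rule nn_integral_FTC_Icc)
    fix x assume "x \<in> {0..b}"
    show "(?F has_field_derivative (b - x) / b * x ^ k) (at x)"
      using DERIV_diff[OF d[of k x] DERIV_cdivide[OF d[of "Suc k" x], of b]] assms
      by (simp add: diff_divide_distrib algebra_simps)
  qed (use assms in auto)
  also have "?F b - ?F 0 = b ^ Suc k * (1 / Suc k - 1 / Suc (Suc k))"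
  proof -
    have "?F b - ?F 0 = b ^ Suc k / Suc k - b ^ Suc k / Suc (Suc k)"
      using assms by (simp del: of_nat_Suc)
    then show ?thesis by (simp only: right_diff_distrib times_divide_eq_right mult_1_right)
  qed
  also have "1 / real (Suc k) - 1 / real (Suc (Suc k)) \<le> 1 / (real (Suc k))\<^sup>2"
    by (simp add: divide_simps power2_eq_square)
  then have "ennreal (b ^ Suc k * (1 / Suc k - 1 / Suc (Suc k))) \<le> ennreal (b ^ Suc k * (1 / (real (Suc k))\<^sup>2))"
    using assms by (intro ennreal_leI mult_left_mono) auto
  finally show ?thesis by simp
qed

text \<open>At fixed height \<open>t\<close> the foot is an affine coordinate on the line, with
  Jacobian \<open>(b - t) / b\<close>. In the coordinates foot and height the integral
  factorises.\<close>

lemma first_point_integral: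
  assumes b: "b > 0" and u: "u \<ge> 0"
  shows "(\<integral>\<^sup>+y. ennreal ((foot a b y * y $ 2) ^ k) *
      indicator {y. 0 \<le> y $ 2 \<and> y $ 2 < b \<and> 0 \<le> foot a b y \<and> foot a b y \<le> u} y \<partial>lborel) \<le>
    ennreal ((u * b) ^ Suc k / real (Suc k) ^ 3)" (is "integral\<^sup>N _ ?h \<le> _")
proof -
  have [measurable]: "(\<lambda>y. foot a b y) \<in> borel_measurable borel"
    unfolding foot_def by measurable
  have m [measurable]: "?h \<in> borel_measurable borel" by measurable
  have inner: "(\<integral>\<^sup>+s. ?h (vector [s, t]) \<partial>lborel) =
      ennreal ((b - t) / b * t ^ k) * indicator {0..b} t * ennreal (u ^ Suc k / Suc k)" for t
  proof (cases "0 \<le> t \<and> t < b")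
    case True
    have c: "(b - t) / b > 0" using True by simp
    have vec: "vector [s, t] = s *\<^sub>R axis 1 1 + t *\<^sub>R (axis 2 1 :: real^2)" for s
      by (simp add: vec2_eq_iff axis_def)
    have [measurable]: "(\<lambda>s. vector [s, t] :: real^2) \<in> borel_measurable borel"
      unfolding vec by measurable
    have ms: "(\<lambda>s. ?h (vector [s, t])) \<in> borel_measurable borel"
      by measurable
    \<comment> \<open>The substituted point lies at height \<open>t\<close> on the line from
      \<open>(a, b)\<close> to \<open>(s, 0)\<close>.\<close>
    have "foot a b (vector [a * t / b + (b - t) / b * s, t]) = s" for s
      using True b by (simp add: foot_def field_simps)
    then have "(\<integral>\<^sup>+s. ?h (vector [s, t]) \<partial>lborel) =
       ennreal ((b - t) / b) * (\<integral>\<^sup>+s. ennreal ((s * t) ^ k) * indicator {0..u} s \<partial>lborel)"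
      using True c
      by (subst nn_integral_real_affine[OF ms, of "(b - t) / b" "a * t / b"])
         (auto intro!: arg_cong2[where f="(*)"] nn_integral_cong simp: indicator_def)
    also have "(\<integral>\<^sup>+s. ennreal ((s * t) ^ k) * indicator {0..u} s \<partial>lborel) =
       (\<integral>\<^sup>+s. ennreal (t ^ k) * (ennreal (s ^ k) * indicator {0..u} s) \<partial>lborel)"
      using True by (intro nn_integral_cong) (auto simp: indicator_def power_mult_distrib ennreal_mult' mult.commute)
    also have "\<dots> = ennreal (t ^ k) * ennreal (u ^ Suc k / Suc k)"
      using u by (subst nn_integral_cmult) (auto simp: nn_integral_power_Icc simp del: power_Suc)
    moreover have "ennreal ((b - t) / b * t ^ k) = ennreal ((b - t) / b) * ennreal (t ^ k)"
      using True c by (intro ennreal_mult) auto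
    ultimately show ?thesis
      using True by (simp add: mult.assoc)
  next
    case False
    \<comment> \<open>At \<open>t = b\<close> the closed interval on the right includes a height
      excluded on the left, but the weight vanishes there.\<close>
    then have "(b - t) / b * t ^ k = 0 \<or> t \<notin> {0..b}" by auto
    then show ?thesis using False by (auto simp: indicator_def)
  qed
  have "integral\<^sup>N lborel ?h = (\<integral>\<^sup>+t. ennreal ((b - t) / b * t ^ k) * indicator {0..b} t \<partial>lborel) * ennreal (u ^ Suc k / Suc k)"
    unfolding nn_integral_vec2[OF m] inner by (subst nn_integral_multc) auto
  also have "\<dots> \<le> ennreal (b ^ Suc k / (real (Suc k))\<^sup>2) * ennreal (u ^ Suc k / Suc k)"
    by (intro mult_right_mono nn_integral_power_hat_Icc b) auto
  also have "\<dots> = ennreal ((u * b) ^ Suc k / real (Suc k) ^ 3)"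
    using b u by (subst ennreal_mult[symmetric])
      (auto simp: power_mult_distrib power2_eq_square power3_eq_cube mult_ac simp del: power_Suc of_nat_Suc)
  finally show ?thesis .
qed

text \<open>\<open>u * b\<close> is twice the area of the current triangle and \<open>c\<close>
  bounds the density. Given the first point \<open>y\<close>, the rest is a chain of a triangle with
  \<open>foot a b y * y $ 2\<close> in place of \<open>u * b\<close>; integrating the bound for
  \<open>k\<close> points over \<open>y\<close> contributes the factor
  \<open>1 / (k + 1)^3\<close>.\<close>

lemma ordered_chain_probability:
  assumes M: "prob_space M" and sets_M [measurable_cong]: "sets M = sets borel"
    and dens: "\<And>h. h \<in> borel_measurable borel \<Longrightarrow> (\<integral>\<^sup>+y. h y \<partial>M) \<le> ennreal c * (\<integral>\<^sup>+y. h y \<partial>lborel)"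
    and c: "c \<ge> 0"
    and "finite I" "set xs \<subseteq> I" "distinct xs" "b \<ge> 0" "u \<ge> 0"
  shows "(\<integral>\<^sup>+x. indicator {x. ordered_chain a b u (map x xs)} x \<partial>(\<Pi>\<^sub>M i\<in>I. M)) \<le>
    ennreal ((c * (u * b)) ^ length xs / fact (length xs) ^ 3)"
  using assms(5-)
proof (induction xs arbitrary: I a b u)
  case Nil
  interpret prob_space "\<Pi>\<^sub>M i\<in>I. M" by (intro prob_space_PiM M)
  show ?case by (simp add: emeasure_space_1)
next
  case (Cons i xs)
  interpret M: prob_space M by (rule M)
  interpret product_sigma_finite "\<lambda>_. M" by standard
  define J where "J = I - {i}"
  have J: "finite J" "i \<notin> J" "I = insert i J" "set xs \<subseteq> J" "distinct xs"
    using Cons.prems by (auto simp: J_def)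
  let ?D = "{y::real^2. 0 \<le> y $ 2 \<and> y $ 2 < b \<and> 0 \<le> foot a b y \<and> foot a b y \<le> u}"
  let ?k = "length xs"
  have [measurable]: "(\<lambda>y. foot a b y) \<in> borel_measurable borel"
    unfolding foot_def by measurable
  have D [measurable]: "?D \<in> sets borel" by measurable
  have "Measurable.pred (\<Pi>\<^sub>M i\<in>I. M) (\<lambda>x. ordered_chain a b u (map (\<lambda>i. x i) (i # xs)))"
  proof (rule measurable_ordered_chain)
    fix j assume "j \<in> set (i # xs)"
    then have "j \<in> I" using Cons.prems(2) by blast
    then show "(\<lambda>x. x j) \<in> borel_measurable (\<Pi>\<^sub>M i\<in>I. M)"
      by measurable
  qed measurable
  then have "(\<lambda>x. if ordered_chain a b u (map x (i # xs)) then 1 else 0 :: ennreal) \<in> borel_measurable (\<Pi>\<^sub>M i\<in>I. M)"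
    by (intro measurable_If) (simp_all only: measurable_const space_borel UNIV_I pred_def)
  moreover have "(indicator {x. ordered_chain a b u (map x (i # xs))} :: _ \<Rightarrow> ennreal) =
      (\<lambda>x. if ordered_chain a b u (map x (i # xs)) then 1 else 0 :: ennreal)"
    by (rule ext) (simp only: indicator_def mem_Collect_eq of_bool_def)
  ultimately have m: "(indicator {x. ordered_chain a b u (map x (i # xs))} :: _ \<Rightarrow> ennreal) \<in>
      borel_measurable (\<Pi>\<^sub>M i\<in>insert i J. M)"
    by (simp only: J(3)[symmetric])
  have "(\<integral>\<^sup>+x. indicator {x. ordered_chain a b u (map x (i # xs))} x \<partial>(\<Pi>\<^sub>M i\<in>I. M)) =
     (\<integral>\<^sup>+y. \<integral>\<^sup>+x. indicator {x. ordered_chain a b u (map x (i # xs))} (x(i := y)) \<partial>(\<Pi>\<^sub>M i\<in>J. M) \<partial>M)"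
    unfolding J(3) by (rule product_nn_integral_insert_rev[OF J(1,2) m])
  also have "\<dots> = (\<integral>\<^sup>+y. \<integral>\<^sup>+x. indicator ?D y *
       indicator {x. ordered_chain (y $ 1) (y $ 2) (foot a b y) (map x xs)} x \<partial>(\<Pi>\<^sub>M i\<in>J. M) \<partial>M)"
  proof -
    have "ordered_chain a b u (map (x(i := y)) (i # xs)) \<longleftrightarrow>
        y \<in> ?D \<and> ordered_chain (y $ 1) (y $ 2) (foot a b y) (map x xs)" for x y
    proof -
      \<comment> \<open>The indices are distinct, so setting coordinate \<open>i\<close> leaves the
        later points alone.\<close>
      have "map (x(i := y)) xs = map x xs"
        using J(2,4) by (intro map_cong) auto
      then show ?thesis
        by (simp only: list.map fun_upd_same ordered_chain.simps mem_Collect_eq conj_assoc)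
    qed
    then show ?thesis
      by (intro nn_integral_cong) (simp only: indicator_def mem_Collect_eq of_bool_conj)
  qed
  also have "\<dots> \<le> (\<integral>\<^sup>+y. ennreal (c ^ ?k / fact ?k ^ 3) * (ennreal ((foot a b y * y $ 2) ^ ?k) * indicator ?D y) \<partial>M)"
  proof (intro nn_integral_mono)
    fix y
    show "(\<integral>\<^sup>+x. indicator ?D y * indicator {x. ordered_chain (y $ 1) (y $ 2) (foot a b y) (map x xs)} x \<partial>(\<Pi>\<^sub>M i\<in>J. M))
       \<le> ennreal (c ^ ?k / fact ?k ^ 3) * (ennreal ((foot a b y * y $ 2) ^ ?k) * indicator ?D y)"
    proof (cases "y \<in> ?D")
      case True
      then have "(\<integral>\<^sup>+x. indicator {x. ordered_chain (y $ 1) (y $ 2) (foot a b y) (map x xs)} x \<partial>(\<Pi>\<^sub>M i\<in>J. M))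
         \<le> ennreal ((c * (foot a b y * y $ 2)) ^ ?k / fact ?k ^ 3)"
        by (intro Cons.IH J) auto
      also have "\<dots> = ennreal (c ^ ?k / fact ?k ^ 3) * ennreal ((foot a b y * y $ 2) ^ ?k)"
        using c True by (subst ennreal_mult[symmetric]) (auto simp: power_mult_distrib)
      finally show ?thesis using True by simp
    qed simp
  qed
  also have "\<dots> \<le> ennreal c * (\<integral>\<^sup>+y. ennreal (c ^ ?k / fact ?k ^ 3) * (ennreal ((foot a b y * y $ 2) ^ ?k) * indicator ?D y) \<partial>lborel)"
    by (intro dens) measurable
  also have "\<dots> = ennreal c * (ennreal (c ^ ?k / fact ?k ^ 3) * (\<integral>\<^sup>+y. ennreal ((foot a b y * y $ 2) ^ ?k) * indicator ?D y \<partial>lborel))"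
    by (subst nn_integral_cmult) auto
  also have "\<dots> \<le> ennreal c * (ennreal (c ^ ?k / fact ?k ^ 3) * ennreal ((u * b) ^ Suc ?k / real (Suc ?k) ^ 3))"
  \<comment> \<open>Apex height 0 does arise in the recursion, when the preceding point lies on the
    axis; no point can follow it.\<close>
  proof (cases "b = 0")
    case True
    then have "?D = {}" by auto
    then show ?thesis by simp
  next
    case False
    then show ?thesis
      using Cons.prems by (intro mult_left_mono first_point_integral) auto
  qed
  also have "\<dots> = ennreal ((c * (u * b)) ^ length (i # xs) / fact (length (i # xs)) ^ 3)"
    using c Cons.prems
    by (simp add: ennreal_mult[symmetric] power_mult_distrib mult_ac)
  finally show ?case .
qed

section \<open>An exponential moment of the longest chain\<close>

lemma ordered_chain_of_unit_chain:
  assumes "convex_chain (vector [0, 1]) (vector [1, 0]) 0 Y"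
  shows "\<exists>zs. distinct zs \<and> set zs = Y \<and> ordered_chain 0 1 1 zs"
proof (rule ordered_chain_exists)
  let ?p0 = "vector [0, 1] :: real^2"
  have ne: "?p0 \<noteq> 0" by (simp add: vec2_eq_iff)
  have Y: "finite Y" "Y \<subseteq> unit_triangle" "?p0 \<notin> Y" "0 \<notin> Y" "in_convex_position (Y \<union> {?p0, 0})"
    using assms unfolding convex_chain_iff[OF ne] by auto
  show "finite Y" by fact
  fix y assume y: "y \<in> Y"
  then have yT: "0 \<le> y $ 1" "0 \<le> y $ 2" "y $ 1 + y $ 2 \<le> 1"
    using Y(2) mem_unit_triangle by blast+
  have "y \<noteq> ?p0" using y Y by blast
  then have "y $ 2 < 1" using yT by (auto simp: vec2_eq_iff)
  then show "0 \<le> y $ 2 \<and> y $ 2 < 1 \<and> 0 \<le> foot 0 1 y \<and> foot 0 1 y \<le> 1"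
    using yT by (simp add: foot_def)
  have "insert ?p0 (insert 0 (Y - {y})) = Y \<union> {?p0, 0} - {y}"
    using y Y by auto
  then show "y \<notin> convex hull (insert ?p0 (insert 0 (Y - {y})))"
    using y Y(5) unfolding in_convex_position_def by simp
qed

text \<open>Each subset of a longest chain is a chain and can be listed in order. Lists of indices
  are counted instead of lists of points; different subsets give different lists because the list
  determines its set.\<close>

lemma two_power_longest_chain_le:
  fixes x :: "nat \<Rightarrow> real^2" and n :: nat
  defines "L \<equiv> longest_chain_length (vector [0, 1]) (vector [1, 0]) 0 (x ` {..<n})"
  shows "2 ^ L \<le> card {xs. set xs \<subseteq> {..<n} \<and> distinct xs \<and> ordered_chain 0 1 1 (map x xs)}"
proof -
  let ?p0 = "vector [0, 1] :: real^2" and ?p1 = "vector [1, 0] :: real^2"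
  let ?Q = "{xs. set xs \<subseteq> {..<n} \<and> distinct xs \<and> ordered_chain 0 1 1 (map x xs)}"
  have ne: "?p0 \<noteq> 0" by (simp add: vec2_eq_iff)
  have fin: "finite ?Q"
    by (rule finite_subset[OF _ finite_subset_distinct[of "{..<n}"]]) auto
  obtain Y where Y: "Y \<subseteq> x ` {..<n}" "convex_chain ?p0 ?p1 0 Y" "card Y = L"
    using longest_chain_attained[of "x ` {..<n}" ?p0 0 ?p1] ne unfolding L_def by auto
  obtain S where S: "S \<subseteq> {..<n}" "inj_on x S" "x ` S = Y"
    using Y(1) unfolding subset_image_inj by auto
  have "Pow S \<subseteq> set ` ?Q"
  proof
    fix S' assume S': "S' \<in> Pow S"
    then have "convex_chain ?p0 ?p1 0 (x ` S')"
      using S(3) by (intro convex_chain_subset[OF ne Y(2)]) auto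
    then obtain zs where zs: "distinct zs" "set zs = x ` S'" "ordered_chain 0 1 1 zs"
      using ordered_chain_of_unit_chain by blast
    have inj: "inj_on x S'" using S' S(2) inj_on_subset by blast
    define xs where "xs = map (the_inv_into S' x) zs"
    have "map x xs = zs"
      unfolding xs_def map_map using zs(2) inj by (intro map_idI) (auto simp: f_the_inv_into_f)
    moreover have "set xs = S'"
      using zs(2) inj by (simp add: xs_def image_image the_inv_into_f_f)
    moreover have "distinct xs"
      using zs(1) \<open>map x xs = zs\<close> by (metis distinct_map)
    ultimately have "xs \<in> ?Q" using zs S' S(1) by auto
    then show "S' \<in> set ` ?Q" using \<open>set xs = S'\<close> by blast
  qed
  then have "card (Pow S) \<le> card ?Q"
    using fin by (meson card_image_le card_mono finite_imageI order_trans)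
  moreover have "card S = L" using S Y(3) card_image by metis
  moreover have "finite S" using S(1) finite_subset by blast
  ultimately show ?thesis by (simp add: card_Pow)
qed

text \<open>For nonnegative terms the sum of cubes is at most the cube of the sum, here of the
  exponential series.\<close>

lemma sum_power_div_fact_cubed_le:
  assumes "0 \<le> (t::real)"
  shows "(\<Sum>k\<le>n. t ^ (3 * k) / fact k ^ 3) \<le> exp (3 * t)"
proof -
  define a where "a = (\<lambda>k. t ^ k / fact k)"
  have a: "0 \<le> a k" for k using assms by (simp add: a_def)
  define S where "S = (\<Sum>k\<le>n. a k)"
  have aS: "a k \<le> S" if "k \<le> n" for k
    unfolding S_def using that a by (intro member_le_sum) auto
  have "S \<le> exp t"
  proof -
    have "a sums exp t"
      using exp_converges[of t] by (simp add: a_def divide_inverse mult.commute)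
    then show ?thesis
      unfolding S_def using a by (metis finite_atMost sum_le_suminf sums_iff)
  qed
  have S0: "0 \<le> S" unfolding S_def using a by (intro sum_nonneg) auto
  have "(\<Sum>k\<le>n. t ^ (3 * k) / fact k ^ 3) = (\<Sum>k\<le>n. a k ^ 3)"
    by (simp add: a_def power_divide power_mult[symmetric] mult.commute)
  also have "\<dots> \<le> (\<Sum>k\<le>n. a k * S\<^sup>2)"
  proof (intro sum_mono)
    fix k assume "k \<in> {..n}"
    then have "a k * (a k)\<^sup>2 \<le> a k * S\<^sup>2"
      using a aS by (intro mult_left_mono power_mono) auto
    then show "a k ^ 3 \<le> a k * S\<^sup>2"
      by (simp add: power3_eq_cube power2_eq_square mult.assoc)
  qed
  also have "\<dots> = S ^ 3"
    by (simp add: sum_distrib_right[symmetric] S_def[symmetric] power3_eq_cube power2_eq_square)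
  also have "\<dots> \<le> exp t ^ 3"
    using \<open>S \<le> exp t\<close> S0 by (rule power_mono)
  also have "\<dots> = exp (3 * t)"
    by (simp add: exp_of_nat_mult[symmetric])
  finally show ?thesis .
qed

lemma mean_two_power_longest_chain:
  fixes n :: nat
  defines "M \<equiv> uniform_triangle (vector [0, 1]) (vector [1, 0]) 0"
  shows "(\<integral>\<^sup>+x. 2 ^ longest_chain_length (vector [0, 1]) (vector [1, 0]) 0 (x ` {..<n}) \<partial>(\<Pi>\<^sub>M i\<in>{..<n}. M)) \<le>
    ennreal (exp (3 * root 3 (4 * real n)))"
proof -
  let ?L = "\<lambda>x. longest_chain_length (vector [0, 1]) (vector [1, 0]) 0 (x ` {..<n})"
  let ?Q = "{xs. set xs \<subseteq> {..<n} \<and> distinct xs}"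
  have M: "prob_space M"
    unfolding M_def by (rule prob_space_uniform_triangle[OF noncollinear_unit_triangle])
  have sM [measurable_cong]: "sets M = sets borel" by (simp add: M_def)
  have fin: "finite ?Q" by (rule finite_subset_distinct) simp
  \<comment> \<open>The density is the reciprocal of the area, and the box bounds the area below by
    \<open>1 / 4\<close>.\<close>
  have dens: "(\<integral>\<^sup>+y. h y \<partial>M) \<le> ennreal 4 * (\<integral>\<^sup>+y. h y \<partial>lborel)" if [measurable]: "h \<in> borel_measurable borel" for h
  proof -
    have "(\<integral>\<^sup>+y. h y \<partial>M) = (\<integral>\<^sup>+y. h y * indicator unit_triangle y \<partial>lborel) / emeasure lborel unit_triangle"
      unfolding M_def by (intro nn_integral_uniform_measure) auto
    also have "\<dots> \<le> ennreal 4 * (\<integral>\<^sup>+y. h y \<partial>lborel)"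
    proof (rule divide_le_posI_ennreal[OF emeasure_unit_triangle_pos])
      have "ennreal 4 * ennreal (1 / 4) = 1"
        by (subst ennreal_mult[symmetric]) simp_all
      then have one: "1 \<le> ennreal 4 * emeasure lborel unit_triangle"
        using mult_left_mono[OF emeasure_unit_triangle_ge, of "ennreal 4"] by simp
      have "(\<integral>\<^sup>+y. h y * indicator unit_triangle y \<partial>lborel) \<le> 1 * (\<integral>\<^sup>+y. h y \<partial>lborel)"
        unfolding mult_1 by (intro nn_integral_mono) (auto simp: indicator_def)
      also have "\<dots> \<le> (ennreal 4 * emeasure lborel unit_triangle) * (\<integral>\<^sup>+y. h y \<partial>lborel)"
        by (intro mult_right_mono one) auto
      finally show "(\<integral>\<^sup>+y. h y * indicator unit_triangle y \<partial>lborel) \<le>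
          emeasure lborel unit_triangle * (ennreal 4 * (\<integral>\<^sup>+y. h y \<partial>lborel))"
        by (simp only: mult_ac)
    qed
    finally show ?thesis .
  qed
  have meas: "(\<lambda>x. indicator {x. ordered_chain 0 1 1 (map x xs)} x :: ennreal) \<in> borel_measurable (\<Pi>\<^sub>M i\<in>{..<n}. M)"
    if xs: "xs \<in> ?Q" for xs
  proof -
    have "Measurable.pred (\<Pi>\<^sub>M i\<in>{..<n}. M) (\<lambda>x. ordered_chain 0 1 1 (map (\<lambda>i. x i) xs))"
    proof (rule measurable_ordered_chain)
      fix j assume "j \<in> set xs"
      then have "j \<in> {..<n}" using xs by blast
      then show "(\<lambda>x. x j) \<in> borel_measurable (\<Pi>\<^sub>M i\<in>{..<n}. M)" by measurable
    qed measurable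
    then have "(\<lambda>x. if ordered_chain 0 1 1 (map x xs) then 1 else 0 :: ennreal) \<in> borel_measurable (\<Pi>\<^sub>M i\<in>{..<n}. M)"
      by (intro measurable_If) (simp_all only: measurable_const space_borel UNIV_I pred_def)
    moreover have "(\<lambda>x. indicator {x. ordered_chain 0 1 1 (map x xs)} x :: ennreal) =
      (\<lambda>x. if ordered_chain 0 1 1 (map x xs) then 1 else 0)"
      by (rule ext) (simp only: indicator_def mem_Collect_eq of_bool_def)
    ultimately show ?thesis by simp
  qed
  have "(\<integral>\<^sup>+x. 2 ^ ?L x \<partial>(\<Pi>\<^sub>M i\<in>{..<n}. M)) \<le>
      (\<integral>\<^sup>+x. (\<Sum>xs\<in>?Q. indicator {x. ordered_chain 0 1 1 (map x xs)} x) \<partial>(\<Pi>\<^sub>M i\<in>{..<n}. M))"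
  proof (intro nn_integral_mono)
    fix x :: "nat \<Rightarrow> real^2"
    have "(2::ennreal) ^ ?L x = of_nat (2 ^ ?L x)" by simp
    also have "\<dots> \<le> of_nat (card {xs. set xs \<subseteq> {..<n} \<and> distinct xs \<and> ordered_chain 0 1 1 (map x xs)})"
      by (intro of_nat_mono two_power_longest_chain_le)
    also have "\<dots> = (\<Sum>xs\<in>?Q. indicator {x. ordered_chain 0 1 1 (map x xs)} x)"
    proof -
      have "{xs. set xs \<subseteq> {..<n} \<and> distinct xs \<and> ordered_chain 0 1 1 (map x xs)} =
        {xs \<in> ?Q. ordered_chain 0 1 1 (map x xs)}" by auto
      moreover have "(\<Sum>xs\<in>?Q. indicator {x. ordered_chain 0 1 1 (map x xs)} x :: ennreal) =
        (\<Sum>xs\<in>?Q. if ordered_chain 0 1 1 (map x xs) then 1 else 0)"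
        by (intro sum.cong refl) (simp only: indicator_def mem_Collect_eq of_bool_def)
      ultimately show ?thesis
        using fin by (simp only: sum.inter_filter[symmetric] card_eq_sum of_nat_sum of_nat_1)
    qed
    finally show "2 ^ ?L x \<le> (\<Sum>xs\<in>?Q. indicator {x. ordered_chain 0 1 1 (map x xs)} x :: ennreal)" .
  qed
  also have "\<dots> = (\<Sum>xs\<in>?Q. \<integral>\<^sup>+x. indicator {x. ordered_chain 0 1 1 (map x xs)} x \<partial>(\<Pi>\<^sub>M i\<in>{..<n}. M))"
    by (intro nn_integral_sum meas)
  also have "\<dots> \<le> (\<Sum>xs\<in>?Q. ennreal (4 ^ length xs / fact (length xs) ^ 3))"
  proof (intro sum_mono)
    fix xs assume "xs \<in> ?Q"
    then show "(\<integral>\<^sup>+x. indicator {x. ordered_chain 0 1 1 (map x xs)} x \<partial>(\<Pi>\<^sub>M i\<in>{..<n}. M)) \<le>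
        ennreal (4 ^ length xs / fact (length xs) ^ 3)"
      using ordered_chain_probability[OF M sM dens, of "{..<n}" xs 1 1 0] by simp
  qed
  also have "\<dots> = ennreal (\<Sum>xs\<in>?Q. 4 ^ length xs / fact (length xs) ^ 3)"
    by (intro sum_ennreal) simp
  also have "(\<Sum>xs\<in>?Q. 4 ^ length xs / fact (length xs) ^ 3) \<le> exp (3 * root 3 (4 * real n))"
  proof -
    have len: "length xs \<le> n" if "xs \<in> ?Q" for xs
      using that card_mono[of "{..<n}" "set xs"] distinct_card[of xs] by auto
    have "(\<Sum>xs\<in>?Q. 4 ^ length xs / fact (length xs) ^ 3 :: real) =
       (\<Sum>k\<le>n. \<Sum>xs\<in>{xs \<in> ?Q. length xs = k}. 4 ^ length xs / fact (length xs) ^ 3)"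
      using len by (intro sum.group[symmetric] fin) auto
    also have "\<dots> = (\<Sum>k\<le>n. real (card {xs \<in> ?Q. length xs = k}) * (4 ^ k / fact k ^ 3))"
      by (intro sum.cong refl) simp
    also have "\<dots> \<le> (\<Sum>k\<le>n. real (n ^ k) * (4 ^ k / fact k ^ 3))"
    proof (intro sum_mono mult_right_mono)
      fix k
      have "card {xs \<in> ?Q. length xs = k} \<le> card {xs. set xs \<subseteq> {..<n} \<and> length xs = k}"
        by (intro card_mono finite_lists_length_eq) auto
      then show "real (card {xs \<in> ?Q. length xs = k}) \<le> real (n ^ k)"
        by (simp add: card_lists_length_eq del: of_nat_power)
    qed simp
    also have "\<dots> = (\<Sum>k\<le>n. root 3 (4 * real n) ^ (3 * k) / fact k ^ 3)"
    proof -
      have "root 3 (4 * real n) ^ 3 = 4 * real n" by (rule real_root_pow_pos2) auto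
      then have "real (n ^ k) * (4 ^ k / fact k ^ 3) = root 3 (4 * real n) ^ (3 * k) / fact k ^ 3" for k
        unfolding power_mult by (simp add: power_mult_distrib)
      then show ?thesis by simp
    qed
    also have "\<dots> \<le> exp (3 * root 3 (4 * real n))"
      by (rule sum_power_div_fact_cubed_le) simp
    finally show ?thesis .
  qed
  finally show ?thesis by (simp add: ennreal_leI)
qed

text \<open>Jensen's inequality for \<open>ln\<close>, via the tangent at the value of the bound.\<close>
lemma mean_longest_chain_upper: "mean_longest_chain n \<le> 3 * root 3 4 / ln 2 * root 3 (real n)"
proof -
  let ?p0 = "vector [0, 1] :: real^2" and ?p1 = "vector [1, 0] :: real^2"
  let ?M = "uniform_triangle ?p0 ?p1 0"
  let ?L = "\<lambda>x. longest_chain_length ?p0 ?p1 0 (x ` {..<n})"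
  define r where "r = 3 * root 3 (4 * real n)"
  have r: "r \<ge> 0" by (simp add: r_def)
  have ne: "?p0 \<noteq> 0" by (simp add: vec2_eq_iff)
  have M: "prob_space ?M" by (rule prob_space_uniform_triangle[OF noncollinear_unit_triangle])
  interpret P: prob_space "\<Pi>\<^sub>M i\<in>{..<n}. ?M" by (intro prob_space_PiM M)
  have L [measurable]: "?L \<in> (\<Pi>\<^sub>M i\<in>{..<n}. ?M) \<rightarrow>\<^sub>M count_space UNIV"
  proof -
    have "(\<lambda>x. longest_chain_length ?p0 ?p1 0 ({} \<union> (\<lambda>i. x i) ` {..<n})) \<in> (\<Pi>\<^sub>M i\<in>{..<n}. ?M) \<rightarrow>\<^sub>M count_space UNIV"
      by (rule measurable_longest_chain[OF ne]) auto
    then show ?thesis by simp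
  qed
  \<comment> \<open>This is \<open>1 + x \<le> exp x\<close> at \<open>x = m * ln 2 - r\<close>. The
    choice of \<open>r\<close> makes the expectation of the last term at most 1, and the 1 stays on
    the left to keep all terms nonnegative.\<close>
  have point: "ln 2 * real m + 1 \<le> r + exp (- r) * 2 ^ m" for m
  proof -
    have "1 + (real m * ln 2 - r) \<le> exp (real m * ln 2 - r)"
      by (rule exp_ge_add_one_self)
    also have "\<dots> = exp (- r) * 2 ^ m"
      by (simp add: exp_diff exp_of_nat_mult exp_minus field_simps)
    finally show ?thesis by (simp add: mult.commute)
  qed
  have "(\<integral>\<^sup>+x. of_nat (?L x) \<partial>(\<Pi>\<^sub>M i\<in>{..<n}. ?M)) = ennreal (mean_longest_chain n)"
    unfolding mean_chain_triangle[OF noncollinear_unit_triangle, symmetric]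
    by (subst mean_chain_eq_PiM[OF ne M]) auto
  then have "ennreal (ln 2) * ennreal (mean_longest_chain n) + 1 =
      (\<integral>\<^sup>+x. ennreal (ln 2) * of_nat (?L x) + 1 \<partial>(\<Pi>\<^sub>M i\<in>{..<n}. ?M))"
    by (subst nn_integral_add) (auto simp: nn_integral_cmult P.emeasure_space_1)
  also have "\<dots> \<le> (\<integral>\<^sup>+x. ennreal r + ennreal (exp (- r)) * 2 ^ ?L x \<partial>(\<Pi>\<^sub>M i\<in>{..<n}. ?M))"
  proof (intro nn_integral_mono)
    fix x
    have "ennreal (ln 2) * of_nat (?L x) + 1 = ennreal (ln 2 * real (?L x) + 1)"
      by (simp add: ennreal_mult ennreal_of_nat_eq_real_of_nat)
    also have "\<dots> \<le> ennreal (r + exp (- r) * 2 ^ ?L x)"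
      by (intro ennreal_leI point)
    also have "\<dots> = ennreal r + ennreal (exp (- r)) * 2 ^ ?L x"
      using r by (simp add: ennreal_mult ennreal_power[symmetric])
    finally show "ennreal (ln 2) * of_nat (?L x) + 1 \<le> ennreal r + ennreal (exp (- r)) * 2 ^ ?L x" .
  qed
  also have "\<dots> = ennreal r + ennreal (exp (- r)) * (\<integral>\<^sup>+x. 2 ^ ?L x \<partial>(\<Pi>\<^sub>M i\<in>{..<n}. ?M))"
    by (subst nn_integral_add) (auto simp: nn_integral_cmult P.emeasure_space_1)
  also have "\<dots> \<le> ennreal r + ennreal (exp (- r)) * ennreal (exp r)"
    unfolding r_def by (intro add_left_mono mult_left_mono mean_two_power_longest_chain) auto
  also have "\<dots> = ennreal (r + 1)"
    using r by (simp add: ennreal_mult[symmetric] exp_minus)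
  finally have *: "ennreal (ln 2 * mean_longest_chain n + 1) \<le> ennreal (r + 1)"
    by (simp add: ennreal_mult mean_longest_chain_def)
  have "ln 2 * mean_longest_chain n + 1 \<le> r + 1"
    by (rule ennreal_le_iff[THEN iffD1, OF _ *]) (use r in simp)
  then show ?thesis
    by (simp add: r_def real_root_mult field_simps)
qed

section \<open>Convergence\<close>

text \<open>For fixed \<open>m\<close>, taking \<open>k\<close> of order
  \<open>(n / m)^(1/3)\<close> in \<open>lower\<close> shows that \<open>g n\<close> is eventually
  almost \<open>g m * theta m\<close>. Since \<open>theta\<close> tends to 1, the supremum of these
  values is the limit of \<open>g\<close>.\<close>

lemma cube_root_limit:
  fixes f :: "nat \<Rightarrow> real"
  assumes mono: "\<And>m n. m \<le> n \<Longrightarrow> f m \<le> f n" and pos: "0 < f 1" and f0: "0 \<le> f 0"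
    and upper: "\<And>n. f n \<le> C * root 3 (real n)"
    and lower: "\<And>k m n. k > 0 \<Longrightarrow> real m < real n / real k ^ 3 \<Longrightarrow>
      real k * (1 - (real n / real k ^ 3) / (real n / real k ^ 3 - real m)\<^sup>2) * f m \<le> f n"
  shows "\<exists>\<alpha>>0. (\<lambda>n. f n / root 3 (real n)) \<longlonglongrightarrow> \<alpha>"
proof -
  have nonneg: "0 \<le> f n" for n using f0 mono[of 0 n] by simp
  define g where "g = (\<lambda>n. f n / root 3 (real n))"
  text \<open>The slack \<open>eps m\<close> tends to \<open>0\<close>, but slowly enough for the Chebyshev error \<open>delta m\<close> to vanish.\<close>
  define eps where "eps = (\<lambda>m::nat. real m powr (- (1/4)))"
  define delta where "delta = (\<lambda>m::nat. (1 + eps m) / (eps m ^ 2 * real m))"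
  \<comment> \<open>\<open>theta\<close> collects both losses: the Chebyshev error, and the cube
    root of the sample surplus \<open>1 + eps m\<close>.\<close>
  define theta where "theta = (\<lambda>m::nat. (1 - delta m) / root 3 (1 + eps m))"
  have theta: "theta \<longlonglongrightarrow> 1"
    unfolding theta_def delta_def eps_def by real_asymp
  have eps: "0 < eps m" if "m > 0" for m using that by (simp add: eps_def)
  \<comment> \<open>The floor is the largest \<open>k\<close> with
    \<open>k^3 * (1 + eps m) * m \<le> n\<close>, that is, with an expected count of at least
    \<open>(1 + eps m) * m\<close> per triangle.\<close>
  define h where "h = (\<lambda>m n. real (nat \<lfloor>root 3 (real n / ((1 + eps m) * real m))\<rfloor>) / root 3 (real n) * (1 - delta m) * f m)"
  have h_lim: "h m \<longlonglongrightarrow> g m * theta m" if m: "m > 0" for m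
  proof -
    define c where "c = (1 + eps m) * real m"
    have c: "c > 0" using m eps[OF m] by (simp add: c_def)
    have "(\<lambda>n. real (nat \<lfloor>root 3 (real n / c)\<rfloor>) / root 3 (real n)) \<longlonglongrightarrow> 1 / root 3 c"
    proof (rule tendsto_sandwich)
      show "\<forall>\<^sub>F n in sequentially. 1 / root 3 c - 1 / root 3 (real n) \<le> real (nat \<lfloor>root 3 (real n / c)\<rfloor>) / root 3 (real n)"
      proof (rule eventually_sequentiallyI[of 1])
        fix n :: nat assume "1 \<le> n"
        then have r: "root 3 (real n) > 0" by simp
        have "root 3 (real n / c) - 1 \<le> real (nat \<lfloor>root 3 (real n / c)\<rfloor>)" by linarith
        then have "(root 3 (real n / c) - 1) / root 3 (real n) \<le> real (nat \<lfloor>root 3 (real n / c)\<rfloor>) / root 3 (real n)"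
          using r by (intro divide_right_mono) auto
        then show "1 / root 3 c - 1 / root 3 (real n) \<le> real (nat \<lfloor>root 3 (real n / c)\<rfloor>) / root 3 (real n)"
          using r by (simp add: real_root_divide diff_divide_distrib)
      qed
      show "\<forall>\<^sub>F n in sequentially. real (nat \<lfloor>root 3 (real n / c)\<rfloor>) / root 3 (real n) \<le> 1 / root 3 c"
      proof (rule eventually_sequentiallyI[of 1])
        fix n :: nat assume "1 \<le> n"
        then have r: "root 3 (real n) > 0" by simp
        have "real (nat \<lfloor>root 3 (real n / c)\<rfloor>) \<le> root 3 (real n / c)"
          using c by (intro of_nat_floor) simp
        then have "real (nat \<lfloor>root 3 (real n / c)\<rfloor>) / root 3 (real n) \<le> root 3 (real n / c) / root 3 (real n)"
          using r by (intro divide_right_mono) auto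
        then show "real (nat \<lfloor>root 3 (real n / c)\<rfloor>) / root 3 (real n) \<le> 1 / root 3 c"
          using r by (simp add: real_root_divide)
      qed
      show "(\<lambda>n. 1 / root 3 c - 1 / root 3 (real n)) \<longlonglongrightarrow> 1 / root 3 c"
        by real_asymp
    qed simp
    then have "h m \<longlonglongrightarrow> 1 / root 3 c * (1 - delta m) * f m"
      unfolding h_def c_def by (intro tendsto_mult tendsto_const)
    moreover have "1 / root 3 c * (1 - delta m) * f m = g m * theta m"
      by (simp add: g_def theta_def c_def real_root_mult mult_ac)
    ultimately show ?thesis by simp
  qed
  have h_le: "h m n \<le> g n" if m: "m > 0" for m n
  proof (cases "nat \<lfloor>root 3 (real n / ((1 + eps m) * real m))\<rfloor> = 0")
    \<comment> \<open>For small \<open>n\<close> the floor is 0 and so is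
      \<open>h m n\<close>.\<close>
    case True
    then show ?thesis using nonneg by (simp add: h_def g_def)
  next
    case False
    define k where "k = nat \<lfloor>root 3 (real n / ((1 + eps m) * real m))\<rfloor>"
    define N where "N = real n / real k ^ 3"
    define e where "e = eps m"
    have e: "e > 0" using eps[OF m] by (simp add: e_def)
    have k: "k > 0" using False by (simp add: k_def)
    have c: "(1 + e) * real m > 0" using m e by simp
    have "real k \<le> root 3 (real n / ((1 + e) * real m))"
      unfolding k_def e_def using c[unfolded e_def] by (intro of_nat_floor) simp
    then have "real k ^ 3 \<le> root 3 (real n / ((1 + e) * real m)) ^ 3"
      by (intro power_mono) auto
    also have "\<dots> = real n / ((1 + e) * real m)"
      using c by (intro real_root_pow_pos2) auto
    finally have N: "(1 + e) * real m \<le> N"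
      using k c by (simp add: N_def field_simps)
    have Npos: "N > 0" using N c by simp
    \<comment> \<open>A rearrangement of \<open>N\<close>: the gap to the mean is at least the
      fraction \<open>e / (1 + e)\<close> of the mean, which is what Chebyshev's bound
      requires.\<close>
    have mN: "e * N \<le> (1 + e) * (N - real m)"
      using N by (simp add: algebra_simps)
    then have lt: "real m < N"
      using e Npos by (smt (verit) mult_pos_pos mult_nonneg_nonpos)
    have "e\<^sup>2 * N * N \<le> ((1 + e) * (N - real m))\<^sup>2"
    proof -
      have "(e * N)\<^sup>2 \<le> ((1 + e) * (N - real m))\<^sup>2"
        using mN e Npos by (intro power_mono) auto
      then show ?thesis by (simp add: power2_eq_square mult_ac)
    qed
    then have "N / (N - real m)\<^sup>2 \<le> (1 + e)\<^sup>2 / (e\<^sup>2 * N)"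
      using lt e Npos by (simp add: divide_simps power_mult_distrib mult_ac)
    \<comment> \<open>The bound decreases in \<open>N\<close>, so the worst case is
      \<open>N = (1 + e) * m\<close>, where it equals \<open>delta m\<close>.\<close>
    also have "\<dots> \<le> (1 + e)\<^sup>2 / (e\<^sup>2 * ((1 + e) * real m))"
    proof (rule divide_left_mono)
      show "e\<^sup>2 * ((1 + e) * real m) \<le> e\<^sup>2 * N"
        using N by (intro mult_left_mono) auto
      show "0 < e\<^sup>2 * N * (e\<^sup>2 * ((1 + e) * real m))"
        by (intro mult_pos_pos c Npos zero_less_power e)
    qed simp
    also have "\<dots> = delta m"
      using e m by (simp add: delta_def e_def[symmetric] power2_eq_square divide_simps)
    finally have "real k * (1 - delta m) * f m \<le> real k * (1 - N / (N - real m)\<^sup>2) * f m"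
      using nonneg by (intro mult_right_mono mult_left_mono) auto
    also have "\<dots> \<le> f n"
      using lower[OF k, of m n] lt by (simp add: N_def)
    finally have "real k * (1 - delta m) * f m / root 3 (real n) \<le> f n / root 3 (real n)"
      by (intro divide_right_mono) auto
    then show ?thesis
      by (simp add: h_def g_def k_def)
  qed
  have g_le: "g n \<le> max C 0" for n
  proof (cases "n = 0")
    \<comment> \<open>For \<open>n = 0\<close> the quotient \<open>g n\<close> is 0 by division by
      zero, hence the maximum with 0.\<close>
    case False
    then have "f n / root 3 (real n) \<le> C" using upper[of n] by (simp add: divide_le_eq)
    then show ?thesis by (simp add: g_def)
  qed (simp add: g_def)
  have q_le: "g m * theta m \<le> max C 0" if "m > 0" for m
    by (rule LIMSEQ_le_const2[OF h_lim[OF that]]) (use h_le[OF that] g_le order_trans in blast)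
  define \<alpha> where "\<alpha> = (SUP m\<in>{0<..}. g m * theta m)"
  have bdd: "bdd_above ((\<lambda>m. g m * theta m) ` {0<..})"
    using q_le by (intro bdd_aboveI[of _ "max C 0"]) auto
  have q_alpha: "g m * theta m \<le> \<alpha>" if "m > 0" for m
    unfolding \<alpha>_def using bdd that by (intro cSUP_upper) auto
  have theta_pos: "\<forall>\<^sub>F m in sequentially. theta m > 0"
    using theta by (rule order_tendstoD) simp
  have "g \<longlonglongrightarrow> \<alpha>"
  proof (rule order_tendstoI)
    fix a assume "a < \<alpha>"
    then obtain m where m: "m > 0" "a < g m * theta m"
      unfolding \<alpha>_def using less_cSUP_iff[OF _ bdd] by auto
    have "\<forall>\<^sub>F n in sequentially. a < h m n"
      using h_lim[OF m(1)] m(2) by (rule order_tendstoD)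
    then show "\<forall>\<^sub>F n in sequentially. a < g n"
      by eventually_elim (use h_le[OF m(1)] in \<open>meson order_less_le_trans\<close>)
  next
    \<comment> \<open>The upper estimate uses \<open>q_alpha\<close> at the index \<open>n\<close>
      itself: \<open>g n \<le> \<alpha> / theta n\<close>, which tends to
      \<open>\<alpha>\<close>.\<close>
    fix b assume b: "\<alpha> < b"
    have "(\<lambda>n. \<alpha> / theta n) \<longlonglongrightarrow> \<alpha> / 1"
      by (intro tendsto_intros theta) simp
    then have "\<forall>\<^sub>F n in sequentially. \<alpha> / theta n < b"
      using b by (intro order_tendstoD) auto
    then show "\<forall>\<^sub>F n in sequentially. g n < b"
      using theta_pos eventually_gt_at_top[of 0]
    proof eventually_elim
      case (elim n)
      then have "g n \<le> \<alpha> / theta n"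
        using q_alpha[of n] by (simp add: le_divide_eq)
      then show ?case using elim by simp
    qed
  qed
  moreover have "\<alpha> > 0"
  proof -
    obtain m where m: "m > 0" "theta m > 0"
      using eventually_happens[OF eventually_conj[OF theta_pos eventually_gt_at_top[of 0]]] by auto
    have "0 < f m" using pos mono[of 1 m] m by simp
    then have "0 < g m * theta m" using m by (simp add: g_def)
    then show ?thesis using q_alpha[OF m(1)] by simp
  qed
  ultimately show ?thesis unfolding g_def by blast
qed

theorem theorem1p1:
  fixes p0 p1 p2 :: "real^2"
  assumes "\<not> collinear {p0, p1, p2}"
  shows "\<exists>\<alpha>::real. \<alpha> > 0 \<and>
    (\<lambda>n. expected_longest_chain p0 p1 p2 n / root 3 (real n)) \<longlonglongrightarrow> \<alpha>"
  unfolding expected_longest_chain_eq[OF assms]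
  by (rule cube_root_limit[OF mean_longest_chain_mono mean_longest_chain_one_pos mean_longest_chain_nonneg
        mean_longest_chain_upper mean_longest_chain_lower])

end
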